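(* Let $\lambda$ be a partition and $\pi$ a reverse plane partition of shape $\lambda$. Define $\pi_1=\pi$ and, as long as $\pi_i$ is not the zero reverse plane partition, let $v_i$ be the minimum of $\mathrm{cand}(\pi_i)$ with respect to the content order, $h_i=h(v_i,\pi_i)$ and $\pi_{i+1}=\pi_i-Q(v_i,\pi_i)$; let $\pi_{s+1}$ be the first reverse plane partition in this sequence with only zero entries. Then $h_i\le h_{i+1}$ for all $i\in[s-1]$ and $\pi=h_1*h_2*\cdots*h_s*0$.
   Context: Cells are pairs $(i,j)\in\mathbb Z^2$; $\mathrm n(i,j)=(i-1,j)$, $\mathrm e(i,j)=(i,j+1)$, $\mathrm s(i,j)=(i+1,j)$, $\mathrm w(i,j)=(i,j-1)$. A partition $\lambda$ is identified with its Young diagram; $\lambda'$ is its conjugate. A reverse plane partition of shape $\lambda$ is $\pi:\lambda\to\mathbb N$ with $\pi(u)\le\pi(\mathrm e u),\pi(\mathrm s u)$, with conventions $\pi(i,j)=0$ if $i\le0$ or $j\le0$, $\pi(i,j)=\infty$ if $i,j\ge1$, $(i,j)\notin\lambda$; $0$ denotes the zero reverse plane partition. Content $c(i,j)=j-i$; outer corner: $u\in\lambda$, $\mathrm e u,\mathrm s u\notin\lambda$; inner corner: $\mathrm e u,\mathrm s u\in\lambda$, $\mathrm e\mathrm s u\notin\lambda$. With inner corner contents $i_1<\dots<i_r$ and outer corner contents $o_1<\dots<o_{r+1}$ (interlacing), $\mathcal I=\{u\in\lambda:c(u)=i_k\}$, $\mathcal O=\{u\in\lambda:c(u)=o_k\}$,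 $\mathcal A=\{u\in\lambda:c(u)<o_1\text{ or }i_k<c(u)<o_{k+1}\text{ for some }k\in[r]\}$, $\mathcal B=\{u\in\lambda:o_k<c(u)<i_k\text{ for some }k\in[r]\text{ or }c(u)>o_{r+1}\}$. Content order: $(i,j)\trianglelefteq(k,l)$ iff $j-i>l-k$, or $j-i=l-k$ and $i\ge k$. Candidates: $\mathrm{cand}(\pi)=\{u\in\mathcal O:\pi(u)>\pi(\mathrm w u)\}\cup\{u\in\mathcal A:\pi(u)>\pi(\mathrm w u),\pi(u)>\pi(\mathrm n u)\}$ (nonempty when $\pi\neq0$). North-east path: $(u_0,\dots,u_s)$ in $\lambda$, $u_k\in\{\mathrm n u_{k-1},\mathrm e u_{k-1}\}$, length $s$, head $\alpha=u_0$, tail $\omega=u_s$. South-west path: $(v_0,\dots,v_s)$, $v_k\in\{\mathrm s v_{k-1},\mathrm w v_{k-1}\}$, length $s$, $\alpha=v_s$, $\omega=v_0$. Rim-hook: north-east path $h$ with $\mathrm s\alpha(h)\notin\lambda$, $\mathrm e\omega(h)\notin\lambda$, $\mathrm e\mathrm s u\notin\lambda$ for all $u\in h$; for $u=(i,j)\in\lambda$, $h^u$ is the rim-hook from $(\lambda'_j,j)$ to $(i,\lambda_i)$, and these are all rim-hooks. Reverse lexicographic order on cells: $(i,j)\le(k,l)$ iff $j>l$, or $j=l$ and $i\ge k$; rim-hooks ordered by $h^u\le h^v$ iff $u\le v$. $(\pi\pm P)(u)=\pi(u)\pm1$ for $u\in P$, else $\pi(u)$. $(P,\pi)$ compatible: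 $u\in P\cap(\mathcal I\cup\mathcal A)$ implies $\mathrm e u\in P$ and $\pi(u)=\pi(\mathrm e u)$; $u,\mathrm s u\in P$ implies $\pi(u)=\pi(\mathrm s u)$. $h$ inserts into $\pi$ if some path $P$ has $\omega(P)=\omega(h)$, $\ell(P)=\ell(h)$, $(P,\pi)$ compatible and $\pi+P$ a reverse plane partition; then $h*\pi=\pi+P(h,\pi)$, with $P(h,\pi)$ the south-west path starting at $\omega(h)$ which, while its length is less than $\ell(h)$, moves from current cell $u$ to $\mathrm s u$ if $u\in\mathcal B\cup\mathcal I$ and $\pi(u)=\pi(\mathrm s u)$, and to $\mathrm w u$ otherwise. Iterated insertion is read right to left. For $v\in\mathrm{cand}(\pi)$, $Q(v,\pi)$ is the north-east path starting at $v$ which, from current cell $u$, moves to $\mathrm n u$ if $u\in\mathcal O\cup\mathcal B$ and $\pi(u)=\pi(\mathrm n u)$; to $\mathrm e u$ if $u\in\mathcal I\cup\mathcal A$, or if $\mathrm e u\in\lambda$ and $\pi(u)>\pi(\mathrm n u)$; and terminates if $\pi(u)>\pi(\mathrm n u)$ and $\mathrm e u\notin\lambda$. $h(v,\pi)$ is the rim-hook with $\omega(h(v,\pi))=\omega(Q(v,\pi))$ and $\ell(h(v,\pi))=\ell(Q(v,\pi))$. *)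

theory Defs
  imports Main "HOL-Library.Extended_Nat"
begin

section \<open>Cells and partitions\<close>

text \<open>Cells use matrix coordinates (row, column), so rows increase to the south.\<close>

type_synonym cell = "int \<times> int"

fun north :: "cell \<Rightarrow> cell" where "north (i, j) = (i - 1, j)"
fun east :: "cell \<Rightarrow> cell" where "east (i, j) = (i, j + 1)"
fun south :: "cell \<Rightarrow> cell" where "south (i, j) = (i + 1, j)"
fun west :: "cell \<Rightarrow> cell" where "west (i, j) = (i, j - 1)"

fun content :: "cell \<Rightarrow> int" where "content (i, j) = j - i"

definition is_partition :: "nat list \<Rightarrow> bool" where
  "is_partition lam \<longleftrightarrow> sorted_wrt (\<ge>) lam \<and> 0 \<notin> set lam"

text \<open>Rows and columns are numbered from 1, list positions from 0.\<close>

definition young_diagram :: "nat list \<Rightarrow> cell set" where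
  "young_diagram lam =
    {(i, j). 1 \<le> i \<and> i \<le> int (length lam) \<and> 1 \<le> j \<and> j \<le> int (lam ! nat (i - 1))}"

text \<open>In everything that follows, \<open>L\<close> stands for a Young diagram. The parts of the partition and
  of its conjugate are read off as row and column lengths.\<close>

definition part :: "cell set \<Rightarrow> int \<Rightarrow> int" where
  "part L i = int (card {j. (i, j) \<in> L})"

definition conj_part :: "cell set \<Rightarrow> int \<Rightarrow> int" where
  "conj_part L j = int (card {i. (i, j) \<in> L})"

definition outer_corner :: "cell set \<Rightarrow> cell \<Rightarrow> bool" where
  "outer_corner L u \<longleftrightarrow> u \<in> L \<and> east u \<notin> L \<and> south u \<notin> L"

definition inner_corner :: "cell set \<Rightarrow> cell \<Rightarrow> bool" where
  "inner_corner L u \<longleftrightarrow> u \<in> L \<and> east u \<in> L \<and> south u \<in> L \<and> east (south u) \<notin> L"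

definition inner_contents :: "cell set \<Rightarrow> int list" where
  "inner_contents L = sorted_list_of_set (content ` {u. inner_corner L u})"

definition outer_contents :: "cell set \<Rightarrow> int list" where
  "outer_contents L = sorted_list_of_set (content ` {u. outer_corner L u})"

definition cells_I :: "cell set \<Rightarrow> cell set" where
  "cells_I L = {u \<in> L. content u \<in> set (inner_contents L)}"

definition cells_O :: "cell set \<Rightarrow> cell set" where
  "cells_O L = {u \<in> L. content u \<in> set (outer_contents L)}"

text \<open>The contents are indexed from 0 here: the list entries at position \<open>k\<close> are the mathematical
  \<open>i\<close> and \<open>o\<close> with index \<open>k + 1\<close>. For the empty diagram \<open>outer_contents L ! 0\<close> is unspecified,
  but then there is no \<open>u \<in> L\<close> to be tested.\<close>

definition cells_A :: "cell set \<Rightarrow> cell set" where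
  "cells_A L = {u \<in> L. content u < outer_contents L ! 0 \<or>
     (\<exists>k < length (inner_contents L).
        inner_contents L ! k < content u \<and> content u < outer_contents L ! Suc k)}"

definition cells_B :: "cell set \<Rightarrow> cell set" where
  "cells_B L = {u \<in> L.
     (\<exists>k < length (inner_contents L).
        outer_contents L ! k < content u \<and> content u < inner_contents L ! k) \<or>
     outer_contents L ! length (inner_contents L) < content u}"

section \<open>Reverse plane partitions\<close>

text \<open>A reverse plane partition is represented by its extension to all cells: 0 on cells with a
  non-positive coordinate, \<open>\<infinity>\<close> on the remaining cells outside the diagram. Hence equality of
  functions is equality of reverse plane partitions.\<close>

definition is_rpp :: "cell set \<Rightarrow> (cell \<Rightarrow> enat) \<Rightarrow> bool" where
  "is_rpp L \<pi> \<longleftrightarrow>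
     (\<forall>i j. i \<le> 0 \<or> j \<le> 0 \<longrightarrow> \<pi> (i, j) = 0) \<and>
     (\<forall>i j. 1 \<le> i \<and> 1 \<le> j \<and> (i, j) \<notin> L \<longrightarrow> \<pi> (i, j) = \<infinity>) \<and>
     (\<forall>u \<in> L. \<pi> u \<noteq> \<infinity> \<and> \<pi> u \<le> \<pi> (east u) \<and> \<pi> u \<le> \<pi> (south u))"

definition zero_rpp :: "cell set \<Rightarrow> cell \<Rightarrow> enat" where
  "zero_rpp L = (\<lambda>(i, j). if i \<le> 0 \<or> j \<le> 0 \<or> (i, j) \<in> L then 0 else \<infinity>)"

definition rpp_add :: "(cell \<Rightarrow> enat) \<Rightarrow> cell set \<Rightarrow> cell \<Rightarrow> enat" where
  "rpp_add \<pi> P = (\<lambda>u. if u \<in> P then \<pi> u + 1 else \<pi> u)"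

text \<open>Subtraction truncates at 0; it is only used for sets \<open>P\<close> on which \<open>\<pi>\<close> is positive.\<close>

definition rpp_sub :: "(cell \<Rightarrow> enat) \<Rightarrow> cell set \<Rightarrow> cell \<Rightarrow> enat" where
  "rpp_sub \<pi> P = (\<lambda>u. if u \<in> P then \<pi> u - 1 else \<pi> u)"

fun content_le :: "cell \<Rightarrow> cell \<Rightarrow> bool" where
  "content_le (i, j) (k, l) \<longleftrightarrow> j - i > l - k \<or> (j - i = l - k \<and> i \<ge> k)"

fun revlex_le :: "cell \<Rightarrow> cell \<Rightarrow> bool" where
  "revlex_le (i, j) (k, l) \<longleftrightarrow> j > l \<or> (j = l \<and> i \<ge> k)"

definition cand :: "cell set \<Rightarrow> (cell \<Rightarrow> enat) \<Rightarrow> cell set" where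
  "cand L \<pi> = {u \<in> cells_O L. \<pi> u > \<pi> (west u)} \<union>
              {u \<in> cells_A L. \<pi> u > \<pi> (west u) \<and> \<pi> u > \<pi> (north u)}"

definition min_cand :: "cell set \<Rightarrow> (cell \<Rightarrow> enat) \<Rightarrow> cell" where
  "min_cand L \<pi> = (THE v. v \<in> cand L \<pi> \<and> (\<forall>u \<in> cand L \<pi>. content_le v u))"

section \<open>Paths and rim-hooks\<close>

text \<open>A path is the list of its cells. A north-east path \<open>p\<close> has head \<open>hd p\<close> and tail \<open>last p\<close>.
  A south-west path runs from its tail to its head; its reversal is a north-east path with the
  same head, tail, length and set of cells.\<close>

definition ne_path :: "cell set \<Rightarrow> cell list \<Rightarrow> bool" where
  "ne_path L p \<longleftrightarrow> p \<noteq> [] \<and> set p \<subseteq> L \<and>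
     (\<forall>k. Suc k < length p \<longrightarrow> p ! Suc k \<in> {north (p ! k), east (p ! k)})"

definition path_len :: "cell list \<Rightarrow> nat" where
  "path_len p = length p - 1"

definition rim_hook :: "cell set \<Rightarrow> cell list \<Rightarrow> bool" where
  "rim_hook L h \<longleftrightarrow> ne_path L h \<and> south (hd h) \<notin> L \<and> east (last h) \<notin> L \<and>
     (\<forall>u \<in> set h. east (south u) \<notin> L)"

fun rim_hook_at :: "cell set \<Rightarrow> cell \<Rightarrow> cell list" where
  "rim_hook_at L (i, j) =
     (THE h. rim_hook L h \<and> hd h = (conj_part L j, j) \<and> last h = (i, part L i))"

definition rim_hook_le :: "cell set \<Rightarrow> cell list \<Rightarrow> cell list \<Rightarrow> bool" where
  "rim_hook_le L g h \<longleftrightarrow>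
     (\<exists>u \<in> L. \<exists>v \<in> L. g = rim_hook_at L u \<and> h = rim_hook_at L v \<and> revlex_le u v)"

section \<open>Insertion\<close>

definition compatible :: "cell set \<Rightarrow> cell set \<Rightarrow> (cell \<Rightarrow> enat) \<Rightarrow> bool" where
  "compatible L P \<pi> \<longleftrightarrow>
     (\<forall>u \<in> P \<inter> (cells_I L \<union> cells_A L). east u \<in> P \<and> \<pi> u = \<pi> (east u)) \<and>
     (\<forall>u. u \<in> P \<and> south u \<in> P \<longrightarrow> \<pi> u = \<pi> (south u))"

definition inserts :: "cell set \<Rightarrow> cell list \<Rightarrow> (cell \<Rightarrow> enat) \<Rightarrow> bool" where
  "inserts L h \<pi> \<longleftrightarrow> rim_hook L h \<and>
     (\<exists>p. ne_path L p \<and> last p = last h \<and> path_len p = path_len h \<and>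
          compatible L (set p) \<pi> \<and> is_rpp L (rpp_add \<pi> (set p)))"

definition P_step :: "cell set \<Rightarrow> (cell \<Rightarrow> enat) \<Rightarrow> cell \<Rightarrow> cell" where
  "P_step L \<pi> u =
     (if u \<in> cells_B L \<union> cells_I L \<and> \<pi> u = \<pi> (south u) then south u else west u)"

definition P_path :: "cell set \<Rightarrow> cell list \<Rightarrow> (cell \<Rightarrow> enat) \<Rightarrow> cell list" where
  "P_path L h \<pi> = map (\<lambda>k. (P_step L \<pi> ^^ k) (last h)) [0..<Suc (path_len h)]"

definition insert_hook :: "cell set \<Rightarrow> cell list \<Rightarrow> (cell \<Rightarrow> enat) \<Rightarrow> (cell \<Rightarrow> enat) option" where
  "insert_hook L h \<pi> =
     (if inserts L h \<pi> then Some (rpp_add \<pi> (set (P_path L h \<pi>))) else None)"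

text \<open>The iterated product \<open>h\<^sub>1 * (\<dots> * (h\<^sub>s * \<pi>))\<close>, defined only if every single insertion is.\<close>

primrec insert_hooks ::
  "cell set \<Rightarrow> cell list list \<Rightarrow> (cell \<Rightarrow> enat) \<Rightarrow> (cell \<Rightarrow> enat) option" where
  "insert_hooks L [] \<pi> = Some \<pi>"
| "insert_hooks L (h # hs) \<pi> = Option.bind (insert_hooks L hs \<pi>) (insert_hook L h)"

section \<open>Extraction\<close>

definition Q_move :: "cell set \<Rightarrow> (cell \<Rightarrow> enat) \<Rightarrow> cell \<Rightarrow> cell \<Rightarrow> bool" where
  "Q_move L \<pi> u u' \<longleftrightarrow>
     (u \<in> cells_O L \<union> cells_B L \<and> \<pi> u = \<pi> (north u) \<and> u' = north u) \<or>
     ((u \<in> cells_I L \<union> cells_A L \<or> (east u \<in> L \<and> \<pi> u > \<pi> (north u))) \<and> u' = east u)"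

definition Q_stop :: "cell set \<Rightarrow> (cell \<Rightarrow> enat) \<Rightarrow> cell \<Rightarrow> bool" where
  "Q_stop L \<pi> u \<longleftrightarrow> \<pi> u > \<pi> (north u) \<and> east u \<notin> L"

text \<open>For \<open>v \<in> cand L \<pi>\<close> exactly one of the two moves and the stopping condition applies to every
  cell that is reached, so there is exactly one such path.\<close>

definition Q_path :: "cell set \<Rightarrow> cell \<Rightarrow> (cell \<Rightarrow> enat) \<Rightarrow> cell list" where
  "Q_path L v \<pi> = (THE q. ne_path L q \<and> hd q = v \<and>
     (\<forall>k. Suc k < length q \<longrightarrow> Q_move L \<pi> (q ! k) (q ! Suc k)) \<and> Q_stop L \<pi> (last q))"

definition Q_hook :: "cell set \<Rightarrow> cell \<Rightarrow> (cell \<Rightarrow> enat) \<Rightarrow> cell list" where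
  "Q_hook L v \<pi> = (THE h. rim_hook L h \<and> last h = last (Q_path L v \<pi>) \<and>
     path_len h = path_len (Q_path L v \<pi>))"

definition reduce_rpp :: "cell set \<Rightarrow> (cell \<Rightarrow> enat) \<Rightarrow> (cell \<Rightarrow> enat)" where
  "reduce_rpp L \<pi> = rpp_sub \<pi> (set (Q_path L (min_cand L \<pi>) \<pi>))"

text \<open>The sequences are indexed from 1, so \<open>rpp_seq L \<pi> 1 = \<pi>\<close>. The values beyond the first zero
  reverse plane partition (and at index 0) are irrelevant.\<close>

definition rpp_seq :: "cell set \<Rightarrow> (cell \<Rightarrow> enat) \<Rightarrow> nat \<Rightarrow> (cell \<Rightarrow> enat)" where
  "rpp_seq L \<pi> i = (reduce_rpp L ^^ (i - 1)) \<pi>"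

definition hook_seq :: "cell set \<Rightarrow> (cell \<Rightarrow> enat) \<Rightarrow> nat \<Rightarrow> cell list" where
  "hook_seq L \<pi> i = Q_hook L (min_cand L (rpp_seq L \<pi> i)) (rpp_seq L \<pi> i)"

end

(* Encode the rim of the diagram by the row of the last cell on each diagonal. A unit step of the rim
   goes east or north, and the classes I, O, A, B of a diagonal are determined by the two rim steps
   meeting on it. For the extraction path Q the decisive invariant is that each cell of Q has a
   strictly larger entry than its north-west neighbour. It follows from the absence of candidates of
   content greater than that of v: a strict increase from west to east at a cell of O or A produces a
   candidate further north in the same column. The invariant shows that subtracting Q leaves a
   reverse plane partition; that insertion retraces Q is then read off from the moves. For the order
   of the hooks, the next candidate has no greater content, and if the content is equal, the next path
   starts weakly above Q, cannot cross it, and cannot stop before it does. *)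

theory Submission
  imports Defs
begin

text \<open>The moves of Q compare an entry only with its north neighbour, and only on diagonals
  that the rim leaves by a north step. Subtraction needs strict inequalities also on the west side
  of Q and at the east moves made without a test. A claim about the north neighbour alone does not
  propagate along the path. The comparison with the north-west neighbour does: after a move north
  the old north-west neighbour is the new west neighbour, and after a move east the old north
  neighbour is the new north-west neighbour. Since Q meets consecutive diagonals once each and ends
  on the rim, its rim-hook is the stretch of the rim over the same diagonals. A rim-hook is
  therefore just a starting content with a length, and the order of rim-hooks compares starting
  contents first and lengths second. This is why the content order on candidates, which prefers
  large contents, yields increasing hooks.\<close>

locale diagram =
  fixes L :: "cell set"
  assumes finite_diagram: "finite L"
    and diagram_pos: "(i, j) \<in> L \<Longrightarrow> 1 \<le> i \<and> 1 \<le> j"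
    and diagram_down: "\<lbrakk>(i, j) \<in> L; 1 \<le> i'; i' \<le> i; 1 \<le> j'; j' \<le> j\<rbrakk> \<Longrightarrow> (i', j') \<in> L"

lemma young_diagram_diagram:
  assumes "is_partition lam"
  shows "diagram (young_diagram lam)"
proof
  have "young_diagram lam \<subseteq> {1..int (length lam)} \<times> {1..int (Max (set lam))}"
    by (fastforce simp: young_diagram_def intro: order_trans)
  then show "finite (young_diagram lam)"
    by (rule finite_subset) simp
next
  fix i j i' j'
  show "(i, j) \<in> young_diagram lam \<Longrightarrow> 1 \<le> i \<and> 1 \<le> j"
    by (simp add: young_diagram_def)
  assume *: "(i, j) \<in> young_diagram lam" "1 \<le> i'" "i' \<le> i" "1 \<le> j'" "j' \<le> j"
  have "lam ! nat (i - 1) \<le> lam ! nat (i' - 1)"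
  proof (cases "i' = i")
    case False
    then show ?thesis
      using * assms by (auto simp: is_partition_def young_diagram_def sorted_wrt_iff_nth_less)
  qed simp
  then show "(i', j') \<in> young_diagram lam"
    using * by (auto simp: young_diagram_def)
qed

text \<open>Turns a comparison with a corner content addressed by its index into a count, so that
  interlacing can be treated as a relation between two counting functions.\<close>

lemma sorted_list_of_set_nth_le_iff:
  fixes A :: "int set"
  assumes "finite A" and "k < card A"
  shows "sorted_list_of_set A ! k \<le> d \<longleftrightarrow> k < card {a \<in> A. a \<le> d}"
proof -
  let ?xs = "sorted_list_of_set A"
  have s: "sorted ?xs" "distinct ?xs" "set ?xs = A" "length ?xs = card A"
    using assms by auto
  show ?thesis
  proof
    assume le: "?xs ! k \<le> d"
    have "set (take (Suc k) ?xs) \<subseteq> {a \<in> A. a \<le> d}"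
    proof
      fix x assume "x \<in> set (take (Suc k) ?xs)"
      then obtain i where "i \<le> k" "x = ?xs ! i" "i < card A"
        using s assms by (auto simp: in_set_conv_nth less_Suc_eq_le)
      moreover from this have "?xs ! i \<le> ?xs ! k"
        using s assms by (simp add: sorted_nth_mono)
      ultimately show "x \<in> {a \<in> A. a \<le> d}"
        using le s assms by (metis (mono_tags, lifting) mem_Collect_eq nth_mem order_trans)
    qed
    then have "card (set (take (Suc k) ?xs)) \<le> card {a \<in> A. a \<le> d}"
      using assms by (intro card_mono) auto
    moreover have "card (set (take (Suc k) ?xs)) = Suc k"
      using s assms by (simp add: distinct_card)
    ultimately show "k < card {a \<in> A. a \<le> d}" by simp
  next
    assume less: "k < card {a \<in> A. a \<le> d}"
    show "?xs ! k \<le> d"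
    proof (rule ccontr)
      assume gt: "\<not> ?xs ! k \<le> d"
      have "{a \<in> A. a \<le> d} \<subseteq> set (take k ?xs)"
      proof
        fix x assume x: "x \<in> {a \<in> A. a \<le> d}"
        then obtain i where i: "i < card A" "x = ?xs ! i"
          using s by (metis (no_types, lifting) in_set_conv_nth mem_Collect_eq)
        have "i < k"
        proof (rule ccontr)
          assume "\<not> i < k"
          then have "?xs ! k \<le> ?xs ! i"
            using s i by (simp add: sorted_nth_mono)
          then show False using gt x i by simp
        qed
        then show "x \<in> set (take k ?xs)"
          using i s by (auto simp: in_set_conv_nth)
      qed
      then have "card {a \<in> A. a \<le> d} \<le> card (set (take k ?xs))"
        by (intro card_mono) auto
      also have "\<dots> \<le> k"
        by (rule order_trans[OF card_length]) simp
      finally show False using less by simp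
    qed
  qed
qed

lemma card_le_split:
  fixes X :: "int set"
  assumes "finite X"
  shows "card {a \<in> X. a \<le> d} = card {a \<in> X. a \<le> d - 1} + (if d \<in> X then 1 else 0)"
proof -
  have "{a \<in> X. a \<le> d} = {a \<in> X. a \<le> d - 1} \<union> (X \<inter> {d})"
    by (auto simp: order_le_less)
  also have "card \<dots> = card {a \<in> X. a \<le> d - 1} + card (X \<inter> {d})"
    using assms by (intro card_Un_disjoint) auto
  finally show ?thesis by simp
qed

section \<open>The rim as a lattice path\<close>

context diagram
begin

text \<open>On an empty diagonal the value \<open>max 0 (- d)\<close> continues the rim along the coordinate axes, so that
  every step from \<open>d\<close> to \<open>d + 1\<close> goes one unit east or one unit north.\<close>

definition rim_row :: "int \<Rightarrow> int" where
  "rim_row d = Max (insert (max 0 (- d)) {k. (k, k + d) \<in> L})"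

definition east_step :: "int \<Rightarrow> bool" where
  "east_step d \<longleftrightarrow> rim_row (d + 1) = rim_row d"

lemma finite_diagonal: "finite {k. (k, k + d) \<in> L}"
  by (rule finite_subset[OF _ finite_imageI[OF finite_diagram, of fst]]) force

text \<open>A diagram is closed under moving north-west along a diagonal, so the last cell decides
  membership. On an empty diagonal the default value excludes everything, since positive coordinates
  force \<open>i > max 0 (- (j - i))\<close>.\<close>

lemma mem_iff: "(i, j) \<in> L \<longleftrightarrow> 1 \<le> i \<and> 1 \<le> j \<and> i \<le> rim_row (j - i)"
proof
  assume *: "(i, j) \<in> L"
  have "i \<le> rim_row (j - i)"
    unfolding rim_row_def using * finite_diagonal by (intro Max_ge) auto
  then show "1 \<le> i \<and> 1 \<le> j \<and> i \<le> rim_row (j - i)"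
    using diagram_pos[OF *] by simp
next
  assume *: "1 \<le> i \<and> 1 \<le> j \<and> i \<le> rim_row (j - i)"
  have "rim_row (j - i) \<in> insert (max 0 (- (j - i))) {k. (k, k + (j - i)) \<in> L}"
    unfolding rim_row_def using finite_diagonal by (intro Max_in) auto
  then have "(rim_row (j - i), rim_row (j - i) + (j - i)) \<in> L"
    using * by auto
  then show "(i, j) \<in> L"
    by (rule diagram_down) (use * in auto)
qed

lemma rim_mem: "(i, j) \<in> L \<Longrightarrow> (rim_row (j - i), rim_row (j - i) + (j - i)) \<in> L"
  unfolding mem_iff by auto

lemma rim_row_cases:
  obtains "rim_row d = max 0 (- d)" | "(rim_row d, rim_row d + d) \<in> L"
proof -
  have "rim_row d \<in> insert (max 0 (- d)) {k. (k, k + d) \<in> L}"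
    unfolding rim_row_def using finite_diagonal by (intro Max_in) auto
  then show ?thesis using that by auto
qed

lemma rim_row_ge: "0 \<le> rim_row d" "- d \<le> rim_row d"
proof -
  have "max 0 (- d) \<le> rim_row d"
    unfolding rim_row_def using finite_diagonal by (intro Max_ge) auto
  then show "0 \<le> rim_row d" "- d \<le> rim_row d" by auto
qed

text \<open>Moving the last cell of a diagonal west or north gives a cell of the adjacent diagonal.
  If this leaves the positive quadrant, the bounds \<open>rim_row_ge\<close> take over.\<close>

lemma rim_row_Suc: "rim_row (d + 1) \<le> rim_row d" "rim_row d \<le> rim_row (d + 1) + 1"
proof -
  show "rim_row (d + 1) \<le> rim_row d"
  proof (cases rule: rim_row_cases[of "d + 1"])
    case 1
    then show ?thesis using rim_row_ge[of d] by auto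
  next
    case 2
    let ?k = "rim_row (d + 1)"
    show ?thesis
    proof (cases "1 \<le> ?k + d")
      case True
      have "(?k, ?k + d) \<in> L"
        by (rule diagram_down[OF 2]) (use True diagram_pos[OF 2] in auto)
      then show ?thesis using mem_iff[of ?k "?k + d"] by simp
    next
      case False
      then show ?thesis using rim_row_ge[of d] by simp
    qed
  qed
  show "rim_row d \<le> rim_row (d + 1) + 1"
  proof (cases rule: rim_row_cases[of d])
    case 1
    then show ?thesis using rim_row_ge[of "d + 1"] by auto
  next
    case 2
    let ?k = "rim_row d"
    show ?thesis
    proof (cases "?k = 1")
      case True
      then show ?thesis using rim_row_ge[of "d + 1"] by simp
    next
      case False
      have "(?k - 1, ?k + d) \<in> L"
        by (rule diagram_down[OF 2]) (use False diagram_pos[OF 2] in auto)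
      then show ?thesis using mem_iff[of "?k - 1" "?k + d"] by (simp add: algebra_simps)
    qed
  qed
qed

lemma not_east_step: "\<not> east_step d \<longleftrightarrow> rim_row d = rim_row (d + 1) + 1"
  using rim_row_Suc[of d] unfolding east_step_def by linarith

lemma rim_row_antimono: "a \<le> b \<Longrightarrow> rim_row b \<le> rim_row a"
proof (induction rule: int_ge_induct)
  case (step b)
  then show ?case using rim_row_Suc(1)[of b] by simp
qed simp

lemma rim_col_mono: "a \<le> b \<Longrightarrow> rim_row a + a \<le> rim_row b + b"
proof (induction rule: int_ge_induct)
  case (step b)
  then show ?case using rim_row_Suc(2)[of b] by simp
qed simp

lemma east_mem:
  assumes "(i, j) \<in> L" and "east_step (j - i)"
  shows "(i, j + 1) \<in> L"
proof -
  have "j + 1 - i = j - i + 1" by simp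
  then show ?thesis
    using assms unfolding mem_iff east_step_def by (simp only:) simp
qed

subsection \<open>Interlacing of the corner contents\<close>

text \<open>At an inner corner the rim arrives going north and departs going east; at an outer
  corner it is the other way round. The membership condition excludes turns that the extended rim
  makes on a coordinate axis.\<close>

lemma inner_contents_iff:
  "d \<in> content ` {u. inner_corner L u} \<longleftrightarrow>
     (rim_row d, rim_row d + d) \<in> L \<and> \<not> east_step (d - 1) \<and> east_step d"
  (is "?l \<longleftrightarrow> ?r")
proof
  assume ?l
  then obtain i j where ij: "d = j - i" "(i, j) \<in> L" "(i, j + 1) \<in> L" "(i + 1, j) \<in> L"
      "(i + 1, j + 1) \<notin> L"
    by (auto simp: inner_corner_def)
  have eqs: "j + 1 - i = d + 1" "j - (i + 1) = d - 1" "j + 1 - (i + 1) = d"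
    using ij by auto
  have "i \<le> rim_row d" "rim_row d < i + 1" "i + 1 \<le> rim_row (d - 1)" "i \<le> rim_row (d + 1)"
    using ij(2-) unfolding mem_iff eqs ij(1)[symmetric] by auto
  then have "rim_row (d - 1) \<noteq> rim_row d" "rim_row (d + 1) = rim_row d"
    using rim_row_Suc[of d] by auto
  then show ?r
    using ij(1) rim_mem[OF ij(2)] by (simp add: east_step_def)
next
  assume r: ?r
  let ?i = "rim_row d" and ?j = "rim_row d + d"
  have eqs: "?j + 1 - ?i = d + 1" "?j - (?i + 1) = d - 1" "?j + 1 - (?i + 1) = d" "?j - ?i = d"
    by auto
  have "rim_row (d - 1) = rim_row d + 1" "rim_row (d + 1) = rim_row d"
    using r not_east_step[of "d - 1"] by (auto simp: east_step_def)
  then have "inner_corner L (?i, ?j)"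
    using r unfolding inner_corner_def north.simps east.simps south.simps mem_iff eqs by auto
  then show ?l by force
qed

lemma outer_contents_iff:
  "d \<in> content ` {u. outer_corner L u} \<longleftrightarrow>
     (rim_row d, rim_row d + d) \<in> L \<and> east_step (d - 1) \<and> \<not> east_step d"
  (is "?l \<longleftrightarrow> ?r")
proof
  assume ?l
  then obtain i j where ij: "d = j - i" "(i, j) \<in> L" "(i, j + 1) \<notin> L" "(i + 1, j) \<notin> L"
    by (auto simp: outer_corner_def)
  have eqs: "j + 1 - i = d + 1" "j - (i + 1) = d - 1"
    using ij by auto
  have "i \<le> rim_row d" "rim_row (d - 1) \<le> i" "rim_row (d + 1) < i"
    using ij(2-) unfolding mem_iff eqs ij(1)[symmetric] by auto
  then have "rim_row (d - 1) = rim_row d" "rim_row (d + 1) \<noteq> rim_row d"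
    using rim_row_Suc[of d] rim_row_Suc[of "d - 1"] by auto
  then show ?r
    using ij(1) rim_mem[OF ij(2)] by (simp add: east_step_def)
next
  assume r: ?r
  let ?i = "rim_row d" and ?j = "rim_row d + d"
  have eqs: "?j + 1 - ?i = d + 1" "?j - (?i + 1) = d - 1" "?j - ?i = d"
    by auto
  have "rim_row (d - 1) = rim_row d" "rim_row (d + 1) = rim_row d - 1"
    using r not_east_step[of d] by (auto simp: east_step_def)
  then have "outer_corner L (?i, ?j)"
    using r unfolding outer_corner_def north.simps east.simps south.simps mem_iff eqs by auto
  then show ?l by force
qed

lemma rim_cell_mem_iff: "(rim_row d, rim_row d + d) \<in> L \<longleftrightarrow> 0 < rim_row d \<and> 0 < rim_row d + d"
  unfolding mem_iff by auto

lemma finite_contents: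
  "finite (content ` {u. inner_corner L u})" "finite (content ` {u. outer_corner L u})"
  by (auto intro!: finite_imageI finite_subset[OF _ finite_diagram]
      simp: inner_corner_def outer_corner_def)

text \<open>This is the interlacing of corners: both counts change only where the rim turns, and
  turns of the two kinds alternate, so their difference is read off from the direction in which the
  rim departs.\<close>

lemma card_contents_le:
  assumes "(rim_row d, rim_row d + d) \<in> L"
  shows "card {a \<in> content ` {u. outer_corner L u}. a \<le> d} =
    card {a \<in> content ` {u. inner_corner L u}. a \<le> d} + (if east_step d then 0 else 1)"
    (is "card (?Out d) = card (?In d) + _")
proof -
  \<comment> \<open>Starting below all contents of \<open>L\<close> makes the base case
    vacuous.\<close>
  obtain b where b: "\<And>u. u \<in> L \<Longrightarrow> b < content u"
  proof -
    have "finite (content ` L)" using finite_diagram by simp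
    then have "Min (insert 0 (content ` L)) - 1 < content u" if "u \<in> L" for u
      using that by (smt (verit) Min_le finite_insert imageI insertCI)
    then show ?thesis using that by blast
  qed
  have "b \<le> d" using b[OF assms] by simp
  then show ?thesis using assms
  proof (induction d rule: int_ge_induct)
    case base
    then show ?case using b by fastforce
  next
    case (step d)
    have split:
      "card (?In (d + 1)) = card (?In d) + (if \<not> east_step d \<and> east_step (d + 1) then 1 else 0)"
      "card (?Out (d + 1)) = card (?Out d) + (if east_step d \<and> \<not> east_step (d + 1) then 1 else 0)"
      using card_le_split[OF finite_contents(1), of "d + 1"]
        card_le_split[OF finite_contents(2), of "d + 1"]
      unfolding inner_contents_iff[of "d + 1"] outer_contents_iff[of "d + 1"]
      by (simp_all only: step.prems simp_thms add_diff_cancel_right')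
    have "card (?Out d) = card (?In d) + (if east_step d then 0 else 1)"
    proof (cases "(rim_row d, rim_row d + d) \<in> L")
      case True
      then show ?thesis by (rule step.IH)
    next
      case False
      \<comment> \<open>Diagonal \<open>d + 1\<close> has a cell and \<open>d\<close> has none, so
        the rim up to \<open>d\<close> runs along column 0, where no corners lie, and enters the
        diagram by the east step at \<open>d\<close>.\<close>
      have d: "rim_row d = - d" "rim_row (d + 1) = - d"
        using False step.prems rim_row_ge[of d] rim_row_Suc[of d]
        unfolding rim_cell_mem_iff by auto
      have empty: "rim_row a = - a" if "a \<le> d" for a
        using that
      proof (induction a rule: int_le_induct)
        case (step a)
        then show ?case using rim_row_ge(2)[of "a - 1"] rim_row_Suc[of "a - 1"] by simp
      qed (use d in simp)
      then have "?Out d = {}" "?In d = {}"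
        unfolding inner_contents_iff outer_contents_iff rim_cell_mem_iff by force+
      then show ?thesis
        using d by (simp only: east_step_def card.empty simp_thms) simp
    qed
    then show ?case
      unfolding split by (simp split: if_split)
  qed
qed

text \<open>Evaluates the difference at the largest content, where the rim must depart north. It
  guarantees that every index into \<open>outer_contents\<close> in the definitions of the classes A
  and B is in range, as long as \<open>L\<close> has a cell.\<close>

lemma card_outer_contents:
  assumes "L \<noteq> {}"
  shows "card (content ` {u. outer_corner L u}) = Suc (card (content ` {u. inner_corner L u}))"
proof -
  let ?d = "Max (content ` L)"
  have fin: "finite (content ` L)" using finite_diagram by simp
  then have "?d \<in> content ` L" using assms by (intro Max_in) auto
  then obtain i j where ij: "(i, j) \<in> L" "j - i = ?d" by auto
  have max: "content u \<le> ?d" if "u \<in> L" for u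
    using that fin by simp
  have r: "(rim_row ?d, rim_row ?d + ?d) \<in> L"
    using rim_mem[OF ij(1)] ij(2) by simp
  have "\<not> east_step ?d"
    using east_mem[OF r] max by fastforce
  moreover have "{a \<in> content ` {u. outer_corner L u}. a \<le> ?d} = content ` {u. outer_corner L u}"
    "{a \<in> content ` {u. inner_corner L u}. a \<le> ?d} = content ` {u. inner_corner L u}"
    using max by (auto simp: inner_corner_def outer_corner_def)
  ultimately show ?thesis
    using card_contents_le[OF r] by simp
qed

lemma cells_O_iff: "(i, j) \<in> cells_O L \<longleftrightarrow> (i, j) \<in> L \<and> east_step (j - i - 1) \<and> \<not> east_step (j - i)"
  unfolding cells_O_def outer_contents_def
    set_sorted_list_of_set[OF finite_contents(2)] mem_Collect_eq content.simps outer_contents_iff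
  using rim_mem[of i j] by blast

lemma cells_I_iff: "(i, j) \<in> cells_I L \<longleftrightarrow> (i, j) \<in> L \<and> \<not> east_step (j - i - 1) \<and> east_step (j - i)"
  unfolding cells_I_def inner_contents_def
    set_sorted_list_of_set[OF finite_contents(1)] mem_Collect_eq content.simps inner_contents_iff
  using rim_mem[of i j] by blast

text \<open>The interval conditions become inequalities between numbers of corner contents up to
  \<open>j - i\<close> and up to \<open>j - i - 1\<close>. The departing direction fixes the
  difference of the former, and a turn on the diagonal itself accounts for the change between the
  two.\<close>

lemma
  shows cells_A_iff: "(i, j) \<in> cells_A L \<longleftrightarrow> (i, j) \<in> L \<and> east_step (j - i - 1) \<and> east_step (j - i)"
    (is ?A)
  and cells_B_iff: "(i, j) \<in> cells_B L \<longleftrightarrow> (i, j) \<in> L \<and> \<not> east_step (j - i - 1) \<and> \<not> east_step (j - i)"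
    (is ?B)
proof -
  let ?d = "j - i"
  let ?In = "content ` {u. inner_corner L u}" and ?Out = "content ` {u. outer_corner L u}"
  let ?n = "card ?In"
  have "?A \<and> ?B"
  proof (cases "(i, j) \<in> L")
    case True
    define a where "a = card {a \<in> ?In. a \<le> ?d}"
    define a' where "a' = card {a \<in> ?In. a \<le> ?d - 1}"
    define b where "b = card {a \<in> ?Out. a \<le> ?d}"
    define b' where "b' = card {a \<in> ?Out. a \<le> ?d - 1}"
    have r: "(rim_row ?d, rim_row ?d + ?d) \<in> L"
      using rim_mem[OF True] .
    have len: "card ?Out = Suc ?n"
      using card_outer_contents True by blast
    have a: "a = a' + (if \<not> east_step (?d - 1) \<and> east_step ?d then 1 else 0)"
      by (simp only: a_def a'_def card_le_split[OF finite_contents(1), of ?d]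
          inner_contents_iff[of ?d] r simp_thms)
    have b: "b = b' + (if east_step (?d - 1) \<and> \<not> east_step ?d then 1 else 0)"
      by (simp only: b_def b'_def card_le_split[OF finite_contents(2), of ?d]
          outer_contents_iff[of ?d] r simp_thms)
    have ab: "b = a + (if east_step ?d then 0 else 1)"
      using card_contents_le[OF r] by (simp add: a_def b_def)
    have an: "a \<le> ?n"
      unfolding a_def using finite_contents by (intro card_mono) auto
    note nth = sorted_list_of_set_nth_le_iff[OF finite_contents(1)]
      sorted_list_of_set_nth_le_iff[OF finite_contents(2)]
    have gtI: "inner_contents L ! k < ?d \<longleftrightarrow> k < a'" "?d < inner_contents L ! k \<longleftrightarrow> a \<le> k"
      if "k < ?n" for k
      using nth(1)[OF that, of "?d - 1"] nth(1)[OF that, of ?d]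
      unfolding inner_contents_def a_def a'_def by linarith+
    have gtO: "outer_contents L ! k < ?d \<longleftrightarrow> k < b'" "?d < outer_contents L ! k \<longleftrightarrow> b \<le> k"
      if "k < Suc ?n" for k
      using nth(2)[of k "?d - 1"] nth(2)[of k ?d] that len
      unfolding outer_contents_def b_def b'_def by linarith+
    have lenI: "length (inner_contents L) = ?n"
      unfolding inner_contents_def by simp
    have "(i, j) \<in> cells_A L \<longleftrightarrow> b = 0 \<or> (\<exists>k < ?n. k < a' \<and> b \<le> Suc k)"
      unfolding cells_A_def lenI using True gtI gtO by auto
    also have "\<dots> \<longleftrightarrow> east_step (?d - 1) \<and> east_step ?d"
    proof
      assume "b = 0 \<or> (\<exists>k < ?n. k < a' \<and> b \<le> Suc k)"
      then show "east_step (?d - 1) \<and> east_step ?d"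
        using a b ab by (auto split: if_splits)
    next
      assume "east_step (?d - 1) \<and> east_step ?d"
      then have "b = a" "a' = a" using a b ab by auto
      \<comment> \<open>Exactly \<open>a\<close> inner corners precede the diagonal, so index
        \<open>a - 1\<close> is the last one passed.\<close>
      then show "b = 0 \<or> (\<exists>k < ?n. k < a' \<and> b \<le> Suc k)"
        using an by (cases "b = 0") (auto intro!: exI[of _ "a - 1"])
    qed
    finally have A: ?A using True by simp
    have "(i, j) \<in> cells_B L \<longleftrightarrow> (\<exists>k < ?n. k < b' \<and> a \<le> k) \<or> ?n < b'"
      unfolding cells_B_def lenI using True gtI gtO by auto
    also have "\<dots> \<longleftrightarrow> \<not> east_step (?d - 1) \<and> \<not> east_step ?d"
    proof
      assume "(\<exists>k < ?n. k < b' \<and> a \<le> k) \<or> ?n < b'"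
      then show "\<not> east_step (?d - 1) \<and> \<not> east_step ?d"
        using a b ab an by (auto split: if_splits)
    next
      assume "\<not> east_step (?d - 1) \<and> \<not> east_step ?d"
      then have "b' = Suc a" using a b ab by auto
      \<comment> \<open>Index \<open>a\<close> is the next inner corner ahead; if there is none, the
        diagonal lies beyond the last outer corner.\<close>
      then show "(\<exists>k < ?n. k < b' \<and> a \<le> k) \<or> ?n < b'"
        using an by (cases "a = ?n") (auto intro!: exI[of _ a])
    qed
    finally show ?thesis using A True by simp
  qed (simp add: cells_A_def cells_B_def)
  then show ?A ?B by blast+
qed

subsection \<open>Rim-hooks\<close>

definition rim :: "int \<Rightarrow> cell" where
  "rim d = (rim_row d, rim_row d + d)"

definition rim_path :: "int \<Rightarrow> nat \<Rightarrow> cell list" where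
  "rim_path a n = map (\<lambda>k. rim (a + int k)) [0..<Suc n]"

text \<open>A rim-hook as an interval of contents. The two step conditions express that the cell
  south of the head and the cell east of the tail are outside \<open>L\<close>.\<close>

definition hook_range :: "int \<Rightarrow> nat \<Rightarrow> bool" where
  "hook_range a n \<longleftrightarrow>
     (\<forall>k \<le> n. rim (a + int k) \<in> L) \<and> east_step (a - 1) \<and> \<not> east_step (a + int n)"

lemma content_rim [simp]: "content (rim d) = d"
  by (simp add: rim_def)

lemma rim_eqI:
  assumes "(i, j) \<in> L" and "(i + 1, j + 1) \<notin> L"
  shows "(i, j) = rim (j - i)"
proof -
  have "j + 1 - (i + 1) = j - i" by simp
  then have "i \<le> rim_row (j - i)" "rim_row (j - i) < i + 1"
    using assms unfolding mem_iff by auto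
  then show ?thesis by (simp add: rim_def)
qed

lemma rim_Suc: "rim (d + 1) = (if east_step d then east (rim d) else north (rim d))"
  using not_east_step[of d] by (auto simp: rim_def east_step_def)

lemma south_rim_iff:
  assumes "rim d \<in> L"
  shows "south (rim d) \<in> L \<longleftrightarrow> \<not> east_step (d - 1)"
proof -
  have *: "rim_row d + d - (rim_row d + 1) = d - 1" by simp
  show ?thesis
    using assms rim_row_Suc[of "d - 1"] not_east_step[of "d - 1"]
    unfolding rim_def south.simps mem_iff * by auto
qed

lemma east_rim_iff:
  assumes "rim d \<in> L"
  shows "east (rim d) \<in> L \<longleftrightarrow> east_step d"
proof -
  have *: "rim_row d + d + 1 - rim_row d = d + 1" by simp
  show ?thesis
    using assms rim_row_Suc[of d]
    unfolding rim_def east.simps mem_iff * by (auto simp: east_step_def)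
qed

lemma east_south_rim: "east (south (rim d)) \<notin> L"
proof -
  have *: "rim_row d + d + 1 - (rim_row d + 1) = d" by simp
  show ?thesis
    unfolding rim_def south.simps east.simps mem_iff * by simp
qed

lemma rim_path_simps [simp]:
  "rim_path a n \<noteq> []" "length (rim_path a n) = Suc n" "path_len (rim_path a n) = n"
  "hd (rim_path a n) = rim a" "last (rim_path a n) = rim (a + int n)"
  "k \<le> n \<Longrightarrow> rim_path a n ! k = rim (a + int k)"
  by (simp_all add: rim_path_def path_len_def hd_map last_map del: upt_Suc)

lemma hook_rangeD:
  assumes "hook_range a n"
  shows "rim a \<in> L" "rim (a + int n) \<in> L" "east_step (a - 1)" "\<not> east_step (a + int n)"
proof -
  have "rim (a + int 0) \<in> L" using assms unfolding hook_range_def by blast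
  then show "rim a \<in> L" by simp
qed (use assms in \<open>simp_all add: hook_range_def\<close>)

lemma rim_hook_rim_path:
  assumes "hook_range a n"
  shows "rim_hook L (rim_path a n)"
proof -
  have "rim_path a n ! Suc k \<in> {north (rim_path a n ! k), east (rim_path a n ! k)}"
    if "Suc k < length (rim_path a n)" for k
    using that rim_Suc[of "a + int k"] by (simp add: algebra_simps)
  moreover have "set (rim_path a n) \<subseteq> L"
    using assms unfolding rim_path_def hook_range_def set_map set_upt by auto
  moreover have "south (rim a) \<notin> L" "east (rim (a + int n)) \<notin> L"
    using hook_rangeD[OF assms] south_rim_iff[of a] east_rim_iff[of "a + int n"] by blast+
  moreover have "east (south u) \<notin> L" if "u \<in> set (rim_path a n)" for u
    using that east_south_rim unfolding rim_path_def by auto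
  ultimately show ?thesis
    by (simp add: rim_hook_def ne_path_def)
qed

lemma ne_path_content:
  assumes "ne_path L p" and "k < length p"
  shows "content (p ! k) = content (hd p) + int k"
  using assms(2)
proof (induction k)
  case 0
  then show ?case by (simp add: hd_conv_nth)
next
  case (Suc k)
  have "p ! Suc k \<in> {north (p ! k), east (p ! k)}"
    using assms(1) Suc.prems by (simp add: ne_path_def)
  then have "content (p ! Suc k) = content (p ! k) + 1"
    by (cases "p ! k") auto
  then show ?case using Suc by simp
qed

text \<open>Each cell of a rim-hook is the last on its diagonal, and contents grow by one along a
  north-east path, so nothing but the start and the length can vary.\<close>

lemma rim_hook_eq:
  assumes "rim_hook L h"
  shows "h = rim_path (content (hd h)) (path_len h)"
proof (rule nth_equalityI)
  have h: "ne_path L h" "h \<noteq> []"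
    using assms by (auto simp: rim_hook_def ne_path_def)
  then show len: "length h = length (rim_path (content (hd h)) (path_len h))"
    by (simp add: path_len_def)
  fix k assume k: "k < length h"
  obtain i j where ij: "h ! k = (i, j)" by (cases "h ! k")
  have "(i, j) \<in> L" "(i + 1, j + 1) \<notin> L"
    using assms k ij nth_mem[OF k] by (auto simp: rim_hook_def ne_path_def)
  then have "h ! k = rim (content (h ! k))"
    using rim_eqI ij by simp
  then show "h ! k = rim_path (content (hd h)) (path_len h) ! k"
    using ne_path_content[OF h(1) k] k len by simp
qed

lemma row_eq:
  assumes "(i, j) \<in> L" and "(i, j + 1) \<notin> L"
  shows "{k. (i, k) \<in> L} = {1..j}"
proof (intro set_eqI iffI)
  fix k assume "k \<in> {k. (i, k) \<in> L}"
  then have k: "(i, k) \<in> L" by simp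
  have "\<not> j + 1 \<le> k"
    using diagram_down[OF k, of i "j + 1"] assms diagram_pos by force
  then show "k \<in> {1..j}" using diagram_pos[OF k] by simp
next
  fix k assume "k \<in> {1..j}"
  then show "k \<in> {k. (i, k) \<in> L}"
    using diagram_down[OF assms(1), of i k] diagram_pos[OF assms(1)] by simp
qed

lemma column_eq:
  assumes "(i, j) \<in> L" and "(i + 1, j) \<notin> L"
  shows "{k. (k, j) \<in> L} = {1..i}"
proof (intro set_eqI iffI)
  fix k assume "k \<in> {k. (k, j) \<in> L}"
  then have k: "(k, j) \<in> L" by simp
  have "\<not> i + 1 \<le> k"
    using diagram_down[OF k, of "i + 1" j] assms diagram_pos by force
  then show "k \<in> {1..i}" using diagram_pos[OF k] by simp
next
  fix k assume "k \<in> {1..i}"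
  then show "k \<in> {k. (k, j) \<in> L}"
    using diagram_down[OF assms(1), of k j] diagram_pos[OF assms(1)] by simp
qed

lemma part_rim:
  assumes "rim d \<in> L" and "\<not> east_step d"
  shows "part L (rim_row d) = rim_row d + d"
proof -
  have "(rim_row d, rim_row d + d + 1) \<notin> L"
    using east_rim_iff assms by (simp add: rim_def)
  then have "{j. (rim_row d, j) \<in> L} = {1..rim_row d + d}"
    using assms(1) by (intro row_eq) (simp_all add: rim_def)
  then show ?thesis
    using assms(1) diagram_pos[of "rim_row d" "rim_row d + d"] by (simp add: part_def rim_def)
qed

lemma conj_part_rim:
  assumes "rim d \<in> L" and "east_step (d - 1)"
  shows "conj_part L (rim_row d + d) = rim_row d"
proof -
  have "(rim_row d + 1, rim_row d + d) \<notin> L"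
    using south_rim_iff assms by (simp add: rim_def)
  then have "{i. (i, rim_row d + d) \<in> L} = {1..rim_row d}"
    using assms(1) by (intro column_eq) (simp_all add: rim_def)
  then show ?thesis
    using assms(1) diagram_pos[of "rim_row d" "rim_row d + d"] by (simp add: conj_part_def rim_def)
qed

text \<open>The indexing cell has the row of the tail and the column of the head. Both ends are
  extremal in their row or column, which identifies them with the part and the conjugate
  part.\<close>

lemma rim_hook_at_rim_path:
  assumes "hook_range a n"
  shows "rim_hook_at L (rim_row (a + int n), rim_row a + a) = rim_path a n"
proof -
  note hr = hook_rangeD[OF assms]
  have "(THE h. rim_hook L h \<and> hd h = rim a \<and> last h = rim (a + int n)) = rim_path a n"
  proof (rule the_equality)
    show "rim_hook L (rim_path a n) \<and> hd (rim_path a n) = rim a \<and>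
        last (rim_path a n) = rim (a + int n)"
      using rim_hook_rim_path[OF assms] by simp
    fix h assume h: "rim_hook L h \<and> hd h = rim a \<and> last h = rim (a + int n)"
    then have eq: "h = rim_path a (path_len h)"
      using rim_hook_eq[of h] by simp
    then have "rim (a + int (path_len h)) = rim (a + int n)"
      using h rim_path_simps(5)[of a "path_len h"] by simp
    then have "content (rim (a + int (path_len h))) = content (rim (a + int n))"
      by (rule arg_cong)
    then show "h = rim_path a n" using eq by simp
  qed
  then show ?thesis
    using conj_part_rim[OF hr(1,3)] part_rim[OF hr(2,4)] by (simp add: rim_def algebra_simps)
qed

text \<open>The rim reaches the head by an east step, so a larger starting content gives a strictly
  larger column of the indexing cell. For equal heads the longer hook ends weakly further
  north.\<close>

lemma rim_hook_le_rim_path: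
  assumes h: "hook_range a n" and h': "hook_range a' n'"
    and le: "a' \<le> a" "a' = a \<Longrightarrow> n \<le> n'"
  shows "rim_hook_le L (rim_path a n) (rim_path a' n')"
proof -
  have mem: "(rim_row (a + int n), rim_row a + a) \<in> L" if "hook_range a n" for a n
    using diagram_down[OF hook_rangeD(2)[OF that, unfolded rim_def], of "rim_row (a + int n)" "rim_row a + a"]
      diagram_pos[OF hook_rangeD(1)[OF that, unfolded rim_def]]
      diagram_pos[OF hook_rangeD(2)[OF that, unfolded rim_def]]
      rim_col_mono[of a "a + int n"] by simp
  have "revlex_le (rim_row (a + int n), rim_row a + a) (rim_row (a' + int n'), rim_row a' + a')"
  proof (cases "a' = a")
    case True
    then show ?thesis
      using le(2) rim_row_antimono[of "a + int n" "a + int n'"] by simp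
  next
    case False
    then have "rim_row a' + a' \<le> rim_row (a - 1) + (a - 1)"
      using le(1) by (intro rim_col_mono) simp
    then show ?thesis
      using hook_rangeD(3)[OF h] by (simp add: east_step_def)
  qed
  then show ?thesis
    unfolding rim_hook_le_def
    using mem[OF h] mem[OF h'] rim_hook_at_rim_path[OF h] rim_hook_at_rim_path[OF h'] by metis
qed

subsection \<open>Candidates\<close>

text \<open>The conventions 0 and \<infinity> extend monotonicity to all pairs of neighbouring
  cells, which spares later arguments a case distinction at the boundary.\<close>

lemma rpp_east_le: "is_rpp L \<pi> \<Longrightarrow> \<pi> (i, j) \<le> \<pi> (i, j + 1)"
proof (cases "(i, j) \<in> L \<or> i \<le> 0 \<or> j \<le> 0")
  case False
  moreover from this have "(i, j + 1) \<notin> L"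
    using diagram_down[of i "j + 1" i j] by auto
  moreover assume "is_rpp L \<pi>"
  ultimately have "\<pi> (i, j + 1) = \<infinity>" by (auto simp: is_rpp_def)
  then show ?thesis by simp
qed (auto simp: is_rpp_def)

lemma rpp_south_le: "is_rpp L \<pi> \<Longrightarrow> \<pi> (i, j) \<le> \<pi> (i + 1, j)"
proof (cases "(i, j) \<in> L \<or> i \<le> 0 \<or> j \<le> 0")
  case False
  moreover from this have "(i + 1, j) \<notin> L"
    using diagram_down[of "i + 1" j i j] by auto
  moreover assume "is_rpp L \<pi>"
  ultimately have "\<pi> (i + 1, j) = \<infinity>" by (auto simp: is_rpp_def)
  then show ?thesis by simp
qed (auto simp: is_rpp_def)

lemma rpp_west_le: "is_rpp L \<pi> \<Longrightarrow> \<pi> (i, j - 1) \<le> \<pi> (i, j)"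
  using rpp_east_le[of \<pi> i "j - 1"] by simp

lemma rpp_north_le: "is_rpp L \<pi> \<Longrightarrow> \<pi> (i - 1, j) \<le> \<pi> (i, j)"
  using rpp_south_le[of \<pi> "i - 1" j] by simp

lemma rpp_north_mem:
  assumes "is_rpp L \<pi>" and "(i, j) \<in> L" and "0 < \<pi> (i - 1, j)"
  shows "(i - 1, j) \<in> L"
proof (rule diagram_down[OF assms(2)])
  show "1 \<le> i - 1"
  proof (rule ccontr)
    assume "\<not> 1 \<le> i - 1"
    then have "\<pi> (i - 1, j) = 0" using assms(1) by (simp add: is_rpp_def)
    then show False using assms(3) by simp
  qed
qed (use diagram_pos[OF assms(2)] in auto)

lemma cand_iff:
  "(i, j) \<in> cand L \<pi> \<longleftrightarrow> (i, j) \<in> L \<and> east_step (j - i - 1) \<and> \<pi> (i, j - 1) < \<pi> (i, j) \<and>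
     (east_step (j - i) \<longrightarrow> \<pi> (i - 1, j) < \<pi> (i, j))"
  by (auto simp: cand_def cells_O_iff cells_A_iff)

text \<open>A cell that fails to be a candidate despite the increase lies in A and equals its north
  neighbour. The increase then passes to that neighbour, whose diagonal is reached by the east step
  departing from the old one. The entry stays positive, so the climb ends inside
  \<open>L\<close>.\<close>

lemma cand_north_exists:
  assumes "is_rpp L \<pi>" and "(i, j) \<in> L" and "east_step (j - i - 1)" and "\<pi> (i, j - 1) < \<pi> (i, j)"
  shows "\<exists>i' \<le> i. (i', j) \<in> cand L \<pi>"
  using assms(2-)
proof (induction "nat i" arbitrary: i rule: less_induct)
  case less
  show ?case
  proof (cases "(i, j) \<in> cand L \<pi>")
    case False
    have eq: "\<pi> (i - 1, j) = \<pi> (i, j)" and step: "east_step (j - i)"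
      using False less.prems rpp_north_le[OF assms(1), of i j] by (auto simp: cand_iff)
    have mem: "(i - 1, j) \<in> L"
      using rpp_north_mem[OF assms(1) less.prems(1)] eq less.prems(3)
      by (metis not_less_zero gr_zeroI)
    have "\<pi> (i - 1, j - 1) < \<pi> (i - 1, j)"
      using rpp_north_le[OF assms(1), of i "j - 1"] less.prems(3) eq by simp
    moreover have "nat (i - 1) < nat i"
      using diagram_pos[OF less.prems(1)] by simp
    ultimately have "\<exists>i' \<le> i - 1. (i', j) \<in> cand L \<pi>"
      using less.hyps[of "i - 1"] mem step by simp
    then obtain i' where "i' \<le> i - 1" "(i', j) \<in> cand L \<pi>" by blast
    then show ?thesis by (intro exI[of _ i']) simp
  qed auto
qed

text \<open>In the leftmost column with a positive entry, the bottom cell is positive, has 0 to its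
  west, and lies on a diagonal reached by an east step; from there a candidate is found by
  climbing.\<close>

lemma cand_nonempty:
  assumes "is_rpp L \<pi>" and "\<pi> \<noteq> zero_rpp L"
  shows "cand L \<pi> \<noteq> {}"
proof -
  let ?pos = "\<lambda>n. \<exists>i j. n = nat j \<and> (i, j) \<in> L \<and> 0 < \<pi> (i, j)"
  obtain u where "\<pi> u \<noteq> zero_rpp L u" using assms(2) by blast
  then obtain i j where "(i, j) \<in> L" "0 < \<pi> (i, j)"
    using assms(1) by (cases u) (auto simp: is_rpp_def zero_rpp_def split: if_splits)
  then have "\<exists>n. ?pos n" by blast
  then obtain n where n: "?pos n" "\<And>n'. n' < n \<Longrightarrow> \<not> ?pos n'"
    using exists_least_iff[of ?pos] by metis
  then obtain i j where ij: "n = nat j" "(i, j) \<in> L" "0 < \<pi> (i, j)" by blast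
  let ?I = "{i. (i, j) \<in> L}"
  have "finite ?I"
    by (rule finite_subset[OF _ finite_imageI[OF finite_diagram, of fst]]) force
  define i' where "i' = Max ?I"
  have i': "(i', j) \<in> L" "\<And>k. (k, j) \<in> L \<Longrightarrow> k \<le> i'"
    unfolding i'_def using Max_in[OF \<open>finite ?I\<close>] Max_ge[OF \<open>finite ?I\<close>] ij by auto
  have mono: "\<pi> (i, j) \<le> \<pi> (k, j)" if "i \<le> k" for k
    using that
  proof (induction rule: int_ge_induct)
    case (step k)
    then show ?case using rpp_south_le[OF assms(1), of k j] by simp
  qed simp
  have pos: "0 < \<pi> (i', j)"
    using mono[of i'] i' ij by force
  have west: "\<pi> (i', j - 1) = 0"
  proof (cases "(i', j - 1) \<in> L")
    case True
    then have "\<not> ?pos (nat (j - 1))"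
      using ij(1) diagram_pos[OF ij(2)] by (intro n(2)) simp
    then show ?thesis using True by auto
  next
    case False
    then have "j - 1 \<le> 0"
      using diagram_down[OF i'(1), of i' "j - 1"] diagram_pos[OF i'(1)] by force
    then show ?thesis using assms(1) by (simp add: is_rpp_def)
  qed
  have "(i' + 1, j) \<notin> L" using i'(2)[of "i' + 1"] by auto
  then have "(i' + 1, j + 1) \<notin> L"
    using diagram_down[of "i' + 1" "j + 1" "i' + 1" j] diagram_pos[OF i'(1)] by auto
  then have rim: "(i', j) = rim (j - i')"
    by (rule rim_eqI[OF i'(1)])
  have "east_step (j - i' - 1)"
    using south_rim_iff[of "j - i'"] \<open>(i' + 1, j) \<notin> L\<close> i'(1) unfolding rim[symmetric] by simp
  then show ?thesis
    using cand_north_exists[OF assms(1) i'(1)] west pos by fastforce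
qed

lemma min_cand:
  assumes "cand L \<pi> \<noteq> {}"
  shows "min_cand L \<pi> \<in> cand L \<pi>" and "\<forall>u \<in> cand L \<pi>. content_le (min_cand L \<pi>) u"
proof -
  have "cand L \<pi> \<subseteq> L" by (auto simp: cand_iff)
  then have "finite (cand L \<pi>)"
    using finite_diagram finite_subset by blast
  then have "\<exists>v \<in> cand L \<pi>. \<forall>u \<in> cand L \<pi>. content_le v u"
    using assms
  proof (induction rule: finite_ne_induct)
    case (singleton x)
    then show ?case by (cases x) simp
  next
    case (insert x F)
    then obtain v where "v \<in> F" "\<forall>u \<in> F. content_le v u" by blast
    moreover have "content_le v x \<or> content_le x v" "content_le x x"
      by (cases v; cases x; auto)+
    moreover have "content_le x u" if "content_le x v" "content_le v u" for u
      using that by (cases v; cases x; cases u; auto)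
    ultimately show ?case by blast
  qed
  then obtain v where v: "v \<in> cand L \<pi> \<and> (\<forall>u \<in> cand L \<pi>. content_le v u)" by blast
  have "u = v" if "content_le u v" "content_le v u" for u
    using that by (cases u; cases v; auto)
  then have "min_cand L \<pi> = v"
    unfolding min_cand_def using v by (intro the_equality) auto
  then show "min_cand L \<pi> \<in> cand L \<pi>" and "\<forall>u \<in> cand L \<pi>. content_le (min_cand L \<pi>) u"
    using v by auto
qed

end

subsection \<open>Extraction paths\<close>

lemma enat_diff_mono: "a \<le> b \<Longrightarrow> a - 1 \<le> (b :: enat) - 1"
  by (cases a; cases b) (auto simp: one_enat_def)

lemma enat_less_imp_le_diff: "a < b \<Longrightarrow> a \<le> (b :: enat) - 1"
  by (cases a; cases b) (auto simp: one_enat_def)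

lemma enat_diff_le: "a - 1 \<le> (a :: enat)"
  by (cases a) (auto simp: one_enat_def)

lemma enat_diff_less: "0 < a \<Longrightarrow> a \<noteq> \<infinity> \<Longrightarrow> a - 1 < (a :: enat)"
  by (cases a) (auto simp: one_enat_def zero_enat_def)

lemma enat_diff_add: "0 < a \<Longrightarrow> (a :: enat) - 1 + 1 = a"
  by (cases a) (auto simp: one_enat_def zero_enat_def)

context diagram
begin

text \<open>O and B together are the diagonals that the rim leaves going north, I and A those that
  it leaves going east; the arriving step is irrelevant for a move.\<close>

lemma Q_move_iff:
  assumes "(i, j) \<in> L"
  shows "Q_move L \<pi> (i, j) u \<longleftrightarrow>
    (\<not> east_step (j - i) \<and> \<pi> (i, j) = \<pi> (i - 1, j) \<and> u = (i - 1, j)) \<or>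
    ((east_step (j - i) \<or> (i, j + 1) \<in> L \<and> \<pi> (i - 1, j) < \<pi> (i, j)) \<and> u = (i, j + 1))"
  using assms by (auto simp: Q_move_def cells_O_iff cells_A_iff cells_I_iff cells_B_iff)

lemma Q_move_unique:
  assumes "u \<in> L" and "Q_move L \<pi> u x" and "Q_move L \<pi> u y"
  shows "x = y"
  using assms by (cases u) (auto simp: Q_move_iff)

lemma Q_stop_no_move:
  assumes "u \<in> L" and "Q_stop L \<pi> u"
  shows "\<not> Q_move L \<pi> u x"
  using assms by (cases u) (auto simp: Q_move_iff Q_stop_def dest: east_mem)

text \<open>Positivity is carried along because it keeps a move north among equal entries from
  reaching row 0.\<close>

lemma Q_move_exists:
  assumes rpp: "is_rpp L \<pi>" and u: "u \<in> L" "0 < \<pi> u" and "\<not> Q_stop L \<pi> u"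
  shows "\<exists>x. Q_move L \<pi> u x \<and> x \<in> L \<and> 0 < \<pi> x \<and> content x = content u + 1"
proof -
  obtain i j where ij: "u = (i, j)" by (cases u)
  have mem: "(i, j) \<in> L" using u ij by simp
  show ?thesis
  proof (cases "\<not> east_step (j - i) \<and> \<pi> (i, j) = \<pi> (i - 1, j)")
    case True
    then show ?thesis
      using rpp_north_mem[OF rpp mem] u by (auto simp: ij Q_move_iff[OF mem])
  next
    case False
    have "\<pi> (i - 1, j) \<le> \<pi> (i, j)" by (rule rpp_north_le[OF rpp])
    then have "Q_move L \<pi> u (i, j + 1)" "(i, j + 1) \<in> L"
      using False assms(4) east_mem[OF mem] by (auto simp: ij Q_move_iff[OF mem] Q_stop_def)
    then show ?thesis
      using rpp_east_le[OF rpp, of i j] u ij by (intro exI[of _ "(i, j + 1)"]) auto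
  qed
qed

text \<open>Contents increase by one with every move, so an unending sequence would be injective
  into the finite set \<open>L\<close>; \<open>m\<close> is the first index at which the path
  stops.\<close>

lemma Q_sequence_exists:
  assumes rpp: "is_rpp L \<pi>" and v: "v \<in> L" "0 < \<pi> v"
  shows "\<exists>c m. c 0 = v \<and>
    (\<forall>k \<le> m. c k \<in> L \<and> 0 < \<pi> (c k) \<and> content (c k) = content v + int k) \<and>
    (\<forall>k < m. Q_move L \<pi> (c k) (c (Suc k))) \<and> Q_stop L \<pi> (c m)"
proof -
  define step where "step u = (SOME x. Q_move L \<pi> u x \<and> x \<in> L \<and> 0 < \<pi> x \<and> content x = content u + 1)"
    for u
  have step: "Q_move L \<pi> u (step u) \<and> step u \<in> L \<and> 0 < \<pi> (step u) \<and> content (step u) = content u + 1"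
    if "u \<in> L" "0 < \<pi> u" "\<not> Q_stop L \<pi> u" for u
    unfolding step_def by (rule someI_ex) (rule Q_move_exists[OF rpp that])
  define c where "c k = (step ^^ k) v" for k
  have inv: "c k \<in> L \<and> 0 < \<pi> (c k) \<and> content (c k) = content v + int k"
    if "\<forall>i < k. \<not> Q_stop L \<pi> (c i)" for k
    using that
  proof (induction k)
    case 0
    then show ?case using v by (simp add: c_def)
  next
    case (Suc k)
    then show ?case using step[of "c k"] by (simp add: c_def)
  qed
  have "\<exists>m. Q_stop L \<pi> (c m)"
  proof (rule ccontr)
    assume "\<nexists>m. Q_stop L \<pi> (c m)"
    then have all: "c k \<in> L" "content (c k) = content v + int k" for k
      using inv[of k] by simp_all
    have "inj c"
    proof (rule injI)
      fix x y assume "c x = c y"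
      then have "content (c x) = content (c y)" by simp
      then show "x = y" unfolding all(2) by simp
    qed
    moreover have "finite (range c)"
      by (rule finite_subset[OF _ finite_diagram]) (use all(1) in auto)
    ultimately show False
      using range_inj_infinite[of c] by blast
  qed
  then obtain m where m: "Q_stop L \<pi> (c m)" "\<And>i. i < m \<Longrightarrow> \<not> Q_stop L \<pi> (c i)"
    using exists_least_iff[of "\<lambda>m. Q_stop L \<pi> (c m)"] by blast
  have "Q_move L \<pi> (c k) (c (Suc k))" if "k < m" for k
  proof -
    have "c k \<in> L" "0 < \<pi> (c k)" using inv[of k] m(2) that by simp_all
    then have "Q_move L \<pi> (c k) (step (c k))" using step m(2)[OF that] by blast
    then show ?thesis by (simp add: c_def)
  qed
  moreover have "c k \<in> L \<and> 0 < \<pi> (c k) \<and> content (c k) = content v + int k" if "k \<le> m" for k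
    using inv[of k] m(2) that by simp
  moreover have "c 0 = v" by (simp add: c_def)
  ultimately show ?thesis using m(1) by (intro exI[of _ c] exI[of _ m]) simp
qed

text \<open>Moves are deterministic and a stopping cell admits none, so no other path can diverge
  from \<open>c\<close>, run past it or end before it.\<close>

lemma Q_path_eq:
  assumes c: "c 0 = v" "\<And>k. k \<le> m \<Longrightarrow> c k \<in> L"
    and move: "\<And>k. k < m \<Longrightarrow> Q_move L \<pi> (c k) (c (Suc k))" and stop: "Q_stop L \<pi> (c m)"
  shows "Q_path L v \<pi> = map c [0..<Suc m]"
  unfolding Q_path_def
proof (rule the_equality)
  let ?q = "map c [0..<Suc m]"
  have nth: "?q ! k = c k" if "k < Suc m" for k
    using that by (simp del: upt_Suc)
  have "ne_path L ?q"
    unfolding ne_path_def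
  proof (intro conjI allI impI)
    show "set ?q \<subseteq> L" using c(2) by auto
    fix k assume "Suc k < length ?q"
    then have k: "k < m" by simp
    show "?q ! Suc k \<in> {north (?q ! k), east (?q ! k)}"
      using move[OF k] k by (auto simp: nth Q_move_def simp del: upt_Suc)
  qed simp
  moreover have "hd ?q = v" "last ?q = c m"
    using c(1) by (simp_all add: hd_map last_map del: upt_Suc)
  moreover have "Q_move L \<pi> (?q ! k) (?q ! Suc k)" if "Suc k < length ?q" for k
    using that move[of k] by (simp add: nth del: upt_Suc)
  ultimately show "ne_path L ?q \<and> hd ?q = v \<and>
      (\<forall>k. Suc k < length ?q \<longrightarrow> Q_move L \<pi> (?q ! k) (?q ! Suc k)) \<and> Q_stop L \<pi> (last ?q)"
    using stop by simp
  fix q assume q: "ne_path L q \<and> hd q = v \<and>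
      (\<forall>k. Suc k < length q \<longrightarrow> Q_move L \<pi> (q ! k) (q ! Suc k)) \<and> Q_stop L \<pi> (last q)"
  then have "q \<noteq> []" by (simp add: ne_path_def)
  have eq: "k \<le> m \<and> q ! k = c k" if "k < length q" for k
    using that
  proof (induction k)
    case 0
    then show ?case using q c(1) \<open>q \<noteq> []\<close> by (simp add: hd_conv_nth)
  next
    case (Suc k)
    then have IH: "k \<le> m" "q ! k = c k" by simp_all
    have mv: "Q_move L \<pi> (c k) (q ! Suc k)" using q Suc.prems IH by metis
    then have "k \<noteq> m" using Q_stop_no_move[OF c(2) stop] by blast
    then have "k < m" using IH by simp
    then show ?case using Q_move_unique[OF c(2)[OF IH(1)] mv move] by simp
  qed
  have last: "last q = c (length q - 1)" "length q - 1 \<le> m"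
    using eq[of "length q - 1"] \<open>q \<noteq> []\<close> by (simp_all add: last_conv_nth)
  have "\<not> length q - 1 < m"
  proof
    assume less: "length q - 1 < m"
    have "Q_stop L \<pi> (c (length q - 1))" using q last(1) by simp
    then show False using Q_stop_no_move[OF c(2)[OF last(2)]] move[OF less] by blast
  qed
  then have "length q = Suc m"
    using last(2) \<open>q \<noteq> []\<close> by (cases q) auto
  then show "q = ?q"
    using eq nth by (intro nth_equalityI) (simp_all del: upt_Suc)
qed

end

text \<open>The path is a function of the distance from \<open>v\<close>, so an index is the same
  thing as a diagonal. Values of \<open>c\<close> beyond \<open>m\<close> are unconstrained.\<close>

locale extraction = diagram L for L +
  fixes \<pi> :: "cell \<Rightarrow> enat" and v :: cell and c :: "nat \<Rightarrow> cell" and m :: nat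
  assumes rpp: "is_rpp L \<pi>"
    and v_def: "v = min_cand L \<pi>"
    and v_cand: "v \<in> cand L \<pi>"
    and v_min: "u \<in> cand L \<pi> \<Longrightarrow> content_le v u"
    and c_0: "c 0 = v"
    and c_mem: "k \<le> m \<Longrightarrow> c k \<in> L"
    and c_pos: "k \<le> m \<Longrightarrow> 0 < \<pi> (c k)"
    and c_content: "k \<le> m \<Longrightarrow> content (c k) = content v + int k"
    and c_move: "k < m \<Longrightarrow> Q_move L \<pi> (c k) (c (Suc k))"
    and c_stop: "Q_stop L \<pi> (c m)"

lemma (in diagram) extraction_exists:
  assumes "is_rpp L \<pi>" and "\<pi> \<noteq> zero_rpp L"
  obtains c m where "extraction L \<pi> (min_cand L \<pi>) c m"
proof -
  let ?v = "min_cand L \<pi>"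
  note v = min_cand[OF cand_nonempty[OF assms]]
  obtain i j where ij: "?v = (i, j)" by (cases ?v)
  then have "(i, j) \<in> L" "\<pi> (i, j - 1) < \<pi> (i, j)"
    using v(1) by (simp_all add: cand_iff)
  then have "?v \<in> L" "0 < \<pi> ?v"
    using order_le_less_trans[OF zero_le] unfolding ij by blast+
  from Q_sequence_exists[OF assms(1) this] obtain c m where
    "c 0 = ?v" "\<forall>k \<le> m. c k \<in> L \<and> 0 < \<pi> (c k) \<and> content (c k) = content ?v + int k"
    "\<forall>k < m. Q_move L \<pi> (c k) (c (Suc k))" "Q_stop L \<pi> (c m)"
    by blast
  then have "extraction L \<pi> ?v c m"
    using v assms(1) by unfold_locales blast+
  then show ?thesis by (rule that)
qed

section \<open>The invariant along Q and the subtraction of Q\<close>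

context extraction
begin

definition Q :: "cell set" where "Q = c ` {..m}"
definition \<rho> :: "cell \<Rightarrow> enat" where "\<rho> = rpp_sub \<pi> Q"

lemma Q_path: "Q_path L v \<pi> = map c [0..<Suc m]"
  by (rule Q_path_eq[OF c_0 c_mem c_move c_stop])

lemma reduce_rpp_eq: "reduce_rpp L \<pi> = \<rho>"
proof -
  have "set (map c [0..<Suc m]) = Q" unfolding Q_def set_map set_upt by auto
  then show ?thesis unfolding reduce_rpp_def \<rho>_def v_def[symmetric] Q_path by simp
qed

lemma c_QI: "k \<le> m \<Longrightarrow> c k \<in> Q"
  by (simp add: Q_def)

lemma Q_E:
  assumes "(i, j) \<in> Q"
  obtains k where "k \<le> m" "c k = (i, j)" "j - i = content v + int k"
proof -
  obtain k where "k \<le> m" "c k = (i, j)"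
    using assms by (auto simp: Q_def)
  then show ?thesis using that c_content[of k] by simp
qed

lemma Q_pos: "u \<in> Q \<Longrightarrow> 0 < \<pi> u"
  using c_pos by (auto simp: Q_def)

lemma Q_finite: "u \<in> Q \<Longrightarrow> \<pi> u \<noteq> \<infinity>"
  using c_mem rpp by (auto simp: Q_def is_rpp_def)

lemma Q_mem: "u \<in> Q \<Longrightarrow> u \<in> L"
  using c_mem by (auto simp: Q_def)

lemma Q_content_unique:
  assumes "u \<in> Q" and "w \<in> Q" and "content u = content w"
  shows "u = w"
proof -
  obtain k l where "k \<le> m" "l \<le> m" "u = c k" "w = c l"
    using assms(1,2) by (auto simp: Q_def)
  then show ?thesis using assms(3) c_content[of k] c_content[of l] by simp
qed

lemma v_props: "v \<in> L" "east_step (content v - 1)"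
  using v_cand by (cases v; simp add: cand_iff)+

text \<open>Otherwise there is a candidate weakly north in column \<open>j\<close>. Going north
  raises the content, so this candidate would precede \<open>v\<close>.\<close>

lemma west_eq:
  assumes "(i, j) \<in> L" and "east_step (j - i - 1)" and "content v < j - i"
  shows "\<pi> (i, j - 1) = \<pi> (i, j)"
proof (rule ccontr)
  assume "\<pi> (i, j - 1) \<noteq> \<pi> (i, j)"
  then have "\<pi> (i, j - 1) < \<pi> (i, j)"
    using rpp_west_le[OF rpp, of i j] by simp
  then obtain i' where "i' \<le> i" "(i', j) \<in> cand L \<pi>"
    using cand_north_exists[OF rpp assms(1,2)] by blast
  then show False
    using v_min[of "(i', j)"] assms(3) by (cases v) auto
qed

lemma c_step:
  assumes "k < m" and "c k = (i, j)"
  obtains "c (Suc k) = (i - 1, j)" "\<not> east_step (j - i)" "\<pi> (i - 1, j) = \<pi> (i, j)"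
  | "c (Suc k) = (i, j + 1)" "east_step (j - i) \<or> \<pi> (i - 1, j) < \<pi> (i, j)" "(i, j + 1) \<in> L"
proof -
  have mem: "(i, j) \<in> L" using c_mem[of k] assms by simp
  have "c (Suc k) \<in> L" using c_mem[of "Suc k"] assms(1) by simp
  then show ?thesis
    using c_move[OF assms(1)] that unfolding assms(2) Q_move_iff[OF mem] by metis
qed

text \<open>Only an east move forced by an east step of the rim is made without looking north.
  Equality with the north cell would there, by \<open>west_eq\<close> applied to that cell, extend
  to the north-west cell.\<close>

lemma exit_east_less:
  assumes k: "k \<le> m" "c k = (i, j)" and nw: "\<pi> (i - 1, j - 1) < \<pi> (i, j)"
    and exit: "k = m \<or> c (Suc k) = (i, j + 1)"
  shows "\<pi> (i - 1, j) < \<pi> (i, j)"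
proof (rule ccontr)
  assume "\<not> ?thesis"
  then have eq: "\<pi> (i - 1, j) = \<pi> (i, j)"
    using rpp_north_le[OF rpp, of i j] by simp
  have mem: "(i, j) \<in> L" "0 < \<pi> (i, j)" using c_mem[of k] c_pos[of k] k by simp_all
  have "k \<noteq> m" using c_stop eq k by (auto simp: Q_stop_def)
  then have "k < m" using k by simp
  from c_step[OF this k(2)] have step: "east_step (j - i)"
    using \<open>k \<noteq> m\<close> exit eq by cases auto
  have "(i - 1, j) \<in> L" using rpp_north_mem[OF rpp mem(1)] mem eq by simp
  then have "\<pi> (i - 1, j - 1) = \<pi> (i - 1, j)"
    using west_eq[of "i - 1" j] step k c_content[of k] by simp
  then show False using nw eq by simp
qed

lemma northwest_less: "k \<le> m \<Longrightarrow> c k = (i, j) \<Longrightarrow> \<pi> (i - 1, j - 1) < \<pi> (i, j)"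
proof (induction k arbitrary: i j)
  case 0
  then have "\<pi> (i, j - 1) < \<pi> (i, j)"
    using v_cand c_0 by (simp add: cand_iff)
  then show ?case
    using rpp_north_le[OF rpp, of i "j - 1"] by simp
next
  case (Suc k)
  obtain a b where ab: "c k = (a, b)" by (cases "c k")
  have k: "k < m" "k \<le> m" using Suc.prems by simp_all
  have nw: "\<pi> (a - 1, b - 1) < \<pi> (a, b)" using Suc.IH[OF k(2) ab] .
  show ?case
  proof (cases rule: c_step[OF k(1) ab])
    case 1
    then have "\<pi> (i, j - 1) < \<pi> (i, j)"
      using nw Suc.prems by auto
    then show ?thesis using rpp_north_le[OF rpp, of i "j - 1"] by simp
  next
    case 2
    then have "\<pi> (i - 1, j - 1) < \<pi> (i, j - 1)"
      using exit_east_less[OF k(2) ab nw] Suc.prems by auto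
    then show ?thesis using rpp_west_le[OF rpp, of i j] by simp
  qed
qed

text \<open>This and \<open>Q_west_less\<close> are the strict inequalities across the border of Q
  that keep \<rho> monotone.\<close>

lemma Q_north_less:
  assumes "(i, j) \<in> Q" and "(i - 1, j) \<notin> Q"
  shows "\<pi> (i - 1, j) < \<pi> (i, j)"
proof -
  obtain k where k: "k \<le> m" "c k = (i, j)" using Q_E[OF assms(1)] by metis
  have "k = m \<or> c (Suc k) = (i, j + 1)"
  proof (cases "k = m")
    case False
    then have "k < m" using k by simp
    then have "c (Suc k) \<in> Q" by (intro c_QI) simp
    from c_step[OF \<open>k < m\<close> k(2)] this assms(2) show ?thesis by cases auto
  qed simp
  then show ?thesis by (rule exit_east_less[OF k northwest_less[OF k]])
qed

text \<open>Apart from \<open>v\<close>, such a cell was entered from the south with an equal entry,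
  and its west neighbour is the north-west neighbour of that southern cell.\<close>

lemma Q_west_less:
  assumes "(i, j) \<in> Q" and "(i, j - 1) \<notin> Q"
  shows "\<pi> (i, j - 1) < \<pi> (i, j)"
proof -
  obtain k where k: "k \<le> m" "c k = (i, j)" using Q_E[OF assms(1)] by metis
  show ?thesis
  proof (cases k)
    case 0
    then show ?thesis using k v_cand c_0 by (simp add: cand_iff)
  next
    case (Suc l)
    obtain a b where ab: "c l = (a, b)" by (cases "c l")
    have l: "l < m" "l \<le> m" using Suc k by simp_all
    show ?thesis
    proof (cases rule: c_step[OF l(1) ab])
      case 1
      then show ?thesis using northwest_less[OF l(2) ab] Suc k by auto
    next
      case 2
      then have "c l = (i, j - 1)" using ab Suc k by auto
      then show ?thesis using assms(2) c_QI[OF l(2)] by simp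
    qed
  qed
qed

lemma rho_simps: "u \<in> Q \<Longrightarrow> \<rho> u = \<pi> u - 1" "u \<notin> Q \<Longrightarrow> \<rho> u = \<pi> u"
  by (simp_all add: \<rho>_def rpp_sub_def)

lemma rho_le: "\<rho> u \<le> \<pi> u"
  by (cases "u \<in> Q") (simp_all add: rho_simps enat_diff_le)

lemma rho_mono:
  assumes "\<pi> u \<le> \<pi> w" and "w \<in> Q \<Longrightarrow> u \<notin> Q \<Longrightarrow> \<pi> u < \<pi> w"
  shows "\<rho> u \<le> \<rho> w"
proof (cases "w \<in> Q")
  case True
  then show ?thesis
    using assms by (cases "u \<in> Q") (simp_all add: rho_simps enat_diff_mono enat_less_imp_le_diff)
next
  case False
  then show ?thesis using rho_le[of u] assms(1) by (simp add: rho_simps)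
qed

lemma rho_rpp: "is_rpp L \<rho>"
proof -
  have "\<rho> u \<noteq> \<infinity> \<and> \<rho> u \<le> \<rho> (east u) \<and> \<rho> u \<le> \<rho> (south u)" if "u \<in> L" for u
  proof -
    obtain i j where ij: "u = (i, j)" by (cases u)
    have "\<rho> u \<noteq> \<infinity>"
    proof
      assume "\<rho> u = \<infinity>"
      then have "\<pi> u = \<infinity>" using rho_le[of u] by simp
      then show False using rpp that unfolding is_rpp_def by blast
    qed
    moreover have "\<rho> (i, j) \<le> \<rho> (i, j + 1)"
      using rpp_east_le[OF rpp, of i j] Q_west_less[of i "j + 1"] by (intro rho_mono) simp_all
    moreover have "\<rho> (i, j) \<le> \<rho> (i + 1, j)"
      using rpp_south_le[OF rpp, of i j] Q_north_less[of "i + 1" j] by (intro rho_mono) simp_all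
    ultimately show ?thesis by (simp add: ij)
  qed
  moreover have "\<rho> (i, j) = \<pi> (i, j)" if "(i, j) \<notin> L" for i j
    using that Q_mem rho_simps(2) by blast
  ultimately show ?thesis
    using rpp diagram_pos unfolding is_rpp_def by (smt (verit, best))
qed

lemma rpp_add_rho: "rpp_add \<rho> Q = \<pi>"
proof
  fix u
  show "rpp_add \<rho> Q u = \<pi> u"
    using Q_pos[of u] enat_diff_add[of "\<pi> u"] by (simp add: rpp_add_def rho_simps)
qed

subsection \<open>Reinsertion\<close>

text \<open>The diagonal of a candidate is reached by an east step, and a path cannot stop where the
  rim departs east, since the east neighbour would be in \<open>L\<close>.\<close>

lemma hook_range_c: "hook_range (content v) m"
proof -
  have "rim (content v + int k) \<in> L" if "k \<le> m" for k
  proof -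
    obtain i j where ij: "c k = (i, j)" by (cases "c k")
    then show ?thesis
      using rim_mem[of i j] c_mem[OF that] c_content[OF that] by (simp add: rim_def)
  qed
  moreover have "\<not> east_step (content v + int m)"
  proof -
    obtain i j where ij: "c m = (i, j)" by (cases "c m")
    then show ?thesis
      using c_stop c_mem[of m] c_content[of m] east_mem[of i j] by (auto simp: Q_stop_def)
  qed
  ultimately show ?thesis using v_props by (simp add: hook_range_def)
qed

lemma c_last: "c m = rim (content v + int m)"
proof -
  obtain i j where ij: "c m = (i, j)" by (cases "c m")
  have mem: "(i, j) \<in> L" "(i, j + 1) \<notin> L"
    using c_stop c_mem[of m] ij by (auto simp: Q_stop_def)
  have "(i + 1, j + 1) \<notin> L"
    using mem diagram_down[of "i + 1" "j + 1" i "j + 1"] diagram_pos[OF mem(1)] by auto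
  then show ?thesis
    using rim_eqI[OF mem(1)] ij c_content[of m] by simp
qed

lemma Q_hook_eq: "Q_hook L v \<pi> = rim_path (content v) m"
proof -
  have last: "last (Q_path L v \<pi>) = rim (content v + int m)"
    unfolding Q_path by (simp add: c_last)
  have len: "path_len (Q_path L v \<pi>) = m"
    unfolding Q_path by (simp add: path_len_def)
  show ?thesis
    unfolding Q_hook_def last len
  proof (rule the_equality)
    show "rim_hook L (rim_path (content v) m) \<and>
        last (rim_path (content v) m) = rim (content v + int m) \<and>
        path_len (rim_path (content v) m) = m"
      using rim_hook_rim_path[OF hook_range_c] by simp
    fix h assume h: "rim_hook L h \<and> last h = rim (content v + int m) \<and> path_len h = m"
    then have eq: "h = rim_path (content (hd h)) m"
      using rim_hook_eq[of h] by simp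
    then have "rim (content (hd h) + int m) = rim (content v + int m)"
      using h rim_path_simps(5)[of "content (hd h)" m] by simp
    then have "content (rim (content (hd h) + int m)) = content (rim (content v + int m))"
      by (rule arg_cong)
    then show "h = rim_path (content v) m" using eq by simp
  qed
qed

text \<open>A north move joins equal entries, both lowered, so insertion goes back south. After an
  east move the cell to the south shares its diagonal with the previous cell of Q and so is not
  lowered; it is now strictly larger, and insertion goes back west.\<close>

lemma P_step_c:
  assumes "k < m"
  shows "P_step L \<rho> (c (Suc k)) = c k"
proof -
  obtain i j where ij: "c k = (i, j)" by (cases "c k")
  have Q: "c k \<in> Q" "c (Suc k) \<in> Q" using assms by (simp_all add: c_QI)
  then have mem: "c k \<in> L" "c (Suc k) \<in> L" using Q_mem by blast+
  show ?thesis
  proof (cases rule: c_step[OF assms ij])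
    case 1
    moreover have "c (Suc k) \<in> cells_B L \<union> cells_I L"
      using 1 mem by (auto simp: cells_B_iff cells_I_iff)
    ultimately show ?thesis
      using Q ij by (simp add: P_step_def rho_simps)
  next
    case 2
    have "(i + 1, j + 1) \<notin> Q"
      using Q_content_unique[of "(i + 1, j + 1)" "c k"] Q(1) ij by auto
    then have "\<rho> (i + 1, j + 1) = \<pi> (i + 1, j + 1)" by (rule rho_simps)
    moreover have "\<rho> (i, j + 1) < \<pi> (i, j + 1)"
      using Q(2) 2 enat_diff_less Q_pos Q_finite by (simp add: rho_simps)
    ultimately have "\<rho> (i, j + 1) \<noteq> \<rho> (i + 1, j + 1)"
      using rpp_south_le[OF rpp, of i "j + 1"] by auto
    then show ?thesis using 2 ij by (simp add: P_step_def)
  qed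
qed

lemma set_P_path: "set (P_path L (rim_path (content v) m) \<rho>) = Q"
proof -
  have "(P_step L \<rho> ^^ k) (c m) = c (m - k)" if "k \<le> m" for k
    using that
  proof (induction k)
    case (Suc k)
    then show ?case using P_step_c[of "m - Suc k"] by (simp add: Suc_diff_Suc)
  qed simp
  then have "set (P_path L (rim_path (content v) m) \<rho>) = (\<lambda>k. c (m - k)) ` {0..<Suc m}"
    unfolding P_path_def set_map set_upt rim_path_simps c_last[symmetric]
    by (intro image_cong) auto
  also have "\<dots> = Q"
  proof
    show "Q \<subseteq> (\<lambda>k. c (m - k)) ` {0..<Suc m}"
    proof
      fix u assume "u \<in> Q"
      then obtain k where k: "k \<le> m" "u = c k" by (auto simp: Q_def)
      then show "u \<in> (\<lambda>k. c (m - k)) ` {0..<Suc m}"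
        by (intro image_eqI[of _ _ "m - k"]) simp_all
    qed
  qed (auto simp: Q_def)
  finally show ?thesis .
qed

text \<open>On I and A the path must go east, and \<open>west_eq\<close> at the cell entered gives
  equal entries. Two vertically adjacent cells of Q are consecutive, joined by a move north.
  Lowering both ends preserves equality.\<close>

lemma compatible_Q: "compatible L Q \<rho>"
proof -
  have east: "east u \<in> Q \<and> \<rho> u = \<rho> (east u)" if u: "u \<in> Q" "u \<in> cells_I L \<union> cells_A L" for u
  proof -
    obtain i j where ij: "u = (i, j)" by (cases u)
    obtain k where k: "k \<le> m" "c k = (i, j)" "j - i = content v + int k"
      using Q_E u(1) ij by metis
    have step: "east_step (j - i)" using u(2) ij by (auto simp: cells_I_iff cells_A_iff)
    then have "k < m"
      using k hook_rangeD(4)[OF hook_range_c] by (cases "k = m") auto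
    from c_step[OF this k(2)] have "c (Suc k) = (i, j + 1)" "(i, j + 1) \<in> L"
      using step by (cases, auto)+
    moreover have "\<pi> (i, j) = \<pi> (i, j + 1)"
      using west_eq[of i "j + 1"] calculation(2) step k by simp
    ultimately show ?thesis
      using u(1) c_QI[of "Suc k"] \<open>k < m\<close> ij by (simp add: rho_simps)
  qed
  have "\<rho> u = \<rho> (south u)" if u: "u \<in> Q" "south u \<in> Q" for u
  proof -
    obtain i j where ij: "u = (i, j)" by (cases u)
    obtain k where k: "k \<le> m" "c k = (i + 1, j)" "j - (i + 1) = content v + int k"
      using Q_E[of "i + 1" j] u(2) ij by auto
    obtain l where l: "l \<le> m" "c l = (i, j)" "j - i = content v + int l"
      using Q_E[of i j] u(1) ij by auto
    have "l = Suc k" "k < m" using k l by simp_all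
    from c_step[OF this(2) k(2)] this(1) have "\<pi> (i, j) = \<pi> (i + 1, j)"
      using l(2) by cases auto
    then show ?thesis using u ij by (simp add: rho_simps)
  qed
  then show ?thesis using east by (auto simp: compatible_def)
qed

lemma insert_hook_eq: "insert_hook L (rim_path (content v) m) \<rho> = Some \<pi>"
proof -
  let ?p = "map c [0..<Suc m]"
  have set: "set ?p = Q" unfolding Q_def set_map set_upt by auto
  have nth: "?p ! k = c k" if "k < Suc m" for k
    using that by (simp del: upt_Suc)
  have "?p ! Suc k \<in> {north (?p ! k), east (?p ! k)}" if "Suc k < length ?p" for k
    using that c_move[of k] by (auto simp: nth Q_move_def simp del: upt_Suc)
  then have "ne_path L ?p"
    using set Q_mem by (auto simp: ne_path_def)
  moreover have "last ?p = rim (content v + int m)"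
    by (simp add: c_last)
  ultimately have "inserts L (rim_path (content v) m) \<rho>"
    unfolding inserts_def
    using rim_hook_rim_path[OF hook_range_c] compatible_Q rpp set
    by (intro conjI exI[of _ ?p]) (simp_all add: path_len_def rpp_add_rho del: upt_Suc)
  then show ?thesis
    by (simp add: insert_hook_def set_P_path rpp_add_rho)
qed

text \<open>The termination measure of repeated extraction. Entries on \<open>L\<close> are finite,
  so \<open>the_enat\<close> is faithful there.\<close>

lemma sum_rho_less: "(\<Sum>u\<in>L. the_enat (\<rho> u)) < (\<Sum>u\<in>L. the_enat (\<pi> u))"
proof (rule sum_strict_mono_ex1[OF finite_diagram])
  have le: "the_enat (\<rho> u) \<le> the_enat (\<pi> u)" if "u \<in> L" for u
  proof -
    have "\<pi> u \<noteq> \<infinity>" using rpp that unfolding is_rpp_def by blast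
    then show ?thesis using rho_le[of u] by (cases "\<pi> u"; cases "\<rho> u") auto
  qed
  then show "\<forall>u\<in>L. the_enat (\<rho> u) \<le> the_enat (\<pi> u)" by blast
  have "v \<in> Q" using c_QI[of 0] c_0 by simp
  then have "the_enat (\<rho> v) < the_enat (\<pi> v)"
    using Q_pos[of v] Q_finite[of v]
    by (cases "\<pi> v") (auto simp: rho_simps one_enat_def zero_enat_def)
  then show "\<exists>u\<in>L. the_enat (\<rho> u) < the_enat (\<pi> u)" using v_props(1) by blast
qed

end

subsection \<open>Monotonicity of the extracted rim-hooks\<close>

context extraction
begin

context
  fixes v' c' m'
  assumes next_extraction: "extraction L \<rho> v' c' m'"
begin

interpretation E: extraction L \<rho> v' c' m'
  by (rule next_extraction)

text \<open>Beyond the diagonal of \<open>v\<close>, \<pi> has no increase from west to east at such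
  a cell, so Q must have created it by containing the west cell alone. But the rim steps east from
  the diagonal of the west cell, which forces Q on to the east cell.\<close>

lemma next_content_le: "content v' \<le> content v"
proof (rule ccontr)
  assume less: "\<not> content v' \<le> content v"
  obtain i j where ij: "v' = (i, j)" by (cases v')
  have cand: "(i, j) \<in> L" "east_step (j - i - 1)" "\<rho> (i, j - 1) < \<rho> (i, j)"
    using E.v_cand unfolding ij cand_iff by simp_all
  have eq: "\<pi> (i, j - 1) = \<pi> (i, j)"
    using west_eq[OF cand(1,2)] less ij by simp
  have notin: "(i, j) \<notin> Q"
  proof
    assume *: "(i, j) \<in> Q"
    then have "(i, j - 1) \<in> Q" using Q_west_less eq by force
    then show False using cand(3) eq * by (simp add: rho_simps)
  qed
  moreover have "(i, j - 1) \<in> Q"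
    using cand(3) eq notin by (auto simp: rho_simps intro: ccontr)
  then obtain k where k: "k \<le> m" "c k = (i, j - 1)"
    using Q_E by metis
  have "k \<noteq> m" using c_stop cand(1) k by (auto simp: Q_stop_def)
  then have "k < m" using k by simp
  from c_step[OF this k(2)] have "c (Suc k) = (i, j)"
    using cand(2) by cases (simp_all add: algebra_simps)
  then show False using notin c_QI[of "Suc k"] \<open>k < m\<close> by simp
qed

text \<open>A new candidate strictly south of \<open>v\<close> on its diagonal was none for \<pi>,
  by minimality of \<open>v\<close>. So it lies in A and equalled its north neighbour, which Q has
  lowered. That neighbour is the second cell of Q.\<close>

lemma next_row_le:
  assumes "content v' = content v"
  shows "fst v' \<le> fst v"
proof (rule ccontr)
  assume less: "\<not> fst v' \<le> fst v"
  obtain i j where ij: "v' = (i, j)" by (cases v')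
  obtain a b where ab: "v = (a, b)" by (cases v)
  have "j - i = b - a" "a < i" using assms less ij ab by simp_all
  have cand: "(i, j) \<in> L" "east_step (j - i - 1)" "\<rho> (i, j - 1) < \<rho> (i, j)"
    "east_step (j - i) \<Longrightarrow> \<rho> (i - 1, j) < \<rho> (i, j)"
    using E.v_cand unfolding ij cand_iff by simp_all
  have "(a, b) \<in> Q" using c_QI[of 0] c_0 ab by simp
  then have notin: "(i, j) \<notin> Q"
    using Q_content_unique[of "(i, j)" "(a, b)"] \<open>j - i = b - a\<close> \<open>a < i\<close> by auto
  have "(i, j - 1) \<notin> Q"
    using Q_E[of i "j - 1"] \<open>j - i = b - a\<close> ab by force
  then have west: "\<pi> (i, j - 1) < \<pi> (i, j)"
    using cand(3) notin by (simp add: rho_simps)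
  have "(i, j) \<notin> cand L \<pi>"
    using v_min[of "(i, j)"] ab \<open>j - i = b - a\<close> \<open>a < i\<close> by auto
  then have step: "east_step (j - i)" and "\<not> \<pi> (i - 1, j) < \<pi> (i, j)"
    using cand(1,2) west by (simp_all add: cand_iff)
  then have north: "\<pi> (i - 1, j) = \<pi> (i, j)"
    using rpp_north_le[OF rpp, of i j] by simp
  have "(i - 1, j) \<in> Q"
    using cand(4)[OF step] north notin by (auto simp: rho_simps intro: ccontr)
  then obtain k where k: "k \<le> m" "c k = (i - 1, j)" "j - (i - 1) = content v + int k"
    using Q_E by metis
  then have "k = Suc 0" "0 < m" using \<open>j - i = b - a\<close> ab by simp_all
  have "c 0 = (a, b)" using c_0 ab by simp
  from c_step[OF \<open>0 < m\<close> this] have "c (Suc 0) = (a, b + 1)"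
    by cases (use step in \<open>simp_all add: \<open>j - i = b - a\<close>\<close>)
  \<comment> \<open>The new candidate is the south-east neighbour of \<open>v\<close>. Then \<pi>
    agrees at \<open>(a, b)\<close>, \<open>(a, b + 1)\<close> and \<open>(i, j)\<close>, which
    squeezes the west neighbour \<open>(a + 1, b)\<close> to the same value.\<close>
  then have "i = a + 1" "j = b + 1" using k \<open>k = Suc 0\<close> by simp_all
  moreover have "(a, b + 1) \<in> L"
    using c_mem[OF k(1)] k(2) calculation by simp
  then have "\<pi> (a, b) = \<pi> (a, b + 1)"
    using west_eq[of a "b + 1"] step \<open>j - i = b - a\<close> ab by simp
  ultimately show False
    using west north rpp_south_le[OF rpp, of a b] by simp
qed

text \<open>Compares the paths diagonal by diagonal, so they can cross only by meeting. Where they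
  meet and Q goes north, both entries were lowered equally and the new path goes north too. A new
  path strictly above Q cannot stop, because its east neighbour lies north-west of a cell of Q and
  hence in \<open>L\<close>.\<close>

lemma next_path_above:
  assumes eq: "content v' = content v" and "k \<le> m"
  shows "k \<le> m' \<and> fst (c' k) \<le> fst (c k)"
  using assms(2)
proof (induction k)
  case 0
  then show ?case using next_row_le[OF eq] c_0 E.c_0 by simp
next
  case (Suc k)
  obtain i j where ij: "c k = (i, j)" by (cases "c k")
  obtain i' j' where ij': "c' k = (i', j')" by (cases "c' k")
  have k: "k < m" "k \<le> m" "k \<le> m'" "i' \<le> i" using Suc ij ij' by simp_all
  have diag: "j' - i' = j - i"
    using c_content[OF k(2)] E.c_content[OF k(3)] eq ij ij' by simp
  have mem: "(i, j) \<in> L" "(i', j') \<in> L" using c_mem[OF k(2)] E.c_mem[OF k(3)] ij ij' by simp_all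
  have north: "\<rho> (i - 1, j) = \<rho> (i, j)" if "c (Suc k) = (i - 1, j)" "\<pi> (i - 1, j) = \<pi> (i, j)"
    using that c_QI[OF k(2)] c_QI[of "Suc k"] k(1) ij by (simp add: rho_simps)
  have "k \<noteq> m'"
  proof
    assume "k = m'"
    then have stop: "(i', j' + 1) \<notin> L" "\<rho> (i' - 1, j') < \<rho> (i', j')"
      using E.c_stop ij' by (simp_all add: Q_stop_def)
    show False
    proof (cases "i' = i")
      case True
      then have "j' = j" using diag by simp
      from c_step[OF k(1) ij] show False
        by cases (use stop north True \<open>j' = j\<close> in auto)
    next
      case False
      then have "(i', j' + 1) \<in> L"
        using diagram_down[OF mem(1), of i' "j' + 1"] diagram_pos[OF mem(2)] k(4) diag by simp
      then show False using stop by simp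
    qed
  qed
  then have k': "k < m'" using k by simp
  have "fst (c' (Suc k)) \<le> fst (c (Suc k))"
  proof (cases "i' = i")
    case True
    then have "j' = j" using diag by simp
    from c_step[OF k(1) ij] show ?thesis
    proof cases
      case 1
      from E.c_step[OF k' ij'] show ?thesis
        by cases (use 1 north True \<open>j' = j\<close> in auto)
    next
      case 2
      from E.c_step[OF k' ij'] show ?thesis
        by cases (use 2 True in auto)
    qed
  next
    case False
    have "fst (c' (Suc k)) \<le> i'"
      using E.c_step[OF k' ij'] by fastforce
    moreover have "i - 1 \<le> fst (c (Suc k))"
      using c_step[OF k(1) ij] by fastforce
    ultimately show ?thesis using False k(4) by simp
  qed
  then show ?case using k' by simp
qed

lemma next_hook_le: "rim_hook_le L (rim_path (content v) m) (rim_path (content v') m')"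
  using next_path_above[of m] next_content_le
  by (intro rim_hook_le_rim_path hook_range_c E.hook_range_c) simp_all

end

end

section \<open>Iterating the extraction\<close>

context diagram
begin

lemma rpp_seq_Suc: "rpp_seq L \<pi> (Suc (Suc i)) = rpp_seq L (reduce_rpp L \<pi>) (Suc i)"
  unfolding rpp_seq_def by (simp add: funpow_swap1)

lemma hook_seq_Suc: "hook_seq L \<pi> (Suc (Suc i)) = hook_seq L (reduce_rpp L \<pi>) (Suc i)"
  by (simp add: hook_seq_def rpp_seq_Suc)

text \<open>From index 2 on, the sequences of \<pi> are those of \<rho>, so the induction peels off
  the first extraction. Its hook heads the list and is thus inserted last, turning \<rho> back into
  \<pi>.\<close>

lemma extraction_terminates:
  assumes "is_rpp L \<pi>"
  shows "\<exists>s. (\<forall>i < s. is_rpp L (rpp_seq L \<pi> (Suc i)) \<and> rpp_seq L \<pi> (Suc i) \<noteq> zero_rpp L) \<and>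
    rpp_seq L \<pi> (Suc s) = zero_rpp L \<and>
    (\<forall>i. Suc i < s \<longrightarrow> rim_hook_le L (hook_seq L \<pi> (Suc i)) (hook_seq L \<pi> (Suc (Suc i)))) \<and>
    insert_hooks L (map (\<lambda>i. hook_seq L \<pi> (Suc i)) [0..<s]) (zero_rpp L) = Some \<pi>"
  using assms
proof (induction "\<Sum>u\<in>L. the_enat (\<pi> u)" arbitrary: \<pi> rule: less_induct)
  case less
  show ?case
  proof (cases "\<pi> = zero_rpp L")
    case True
    then show ?thesis by (intro exI[of _ 0]) (simp add: rpp_seq_def)
  next
    case False
    then obtain c m where ex: "extraction L \<pi> (min_cand L \<pi>) c m"
      using extraction_exists[OF less.prems] by blast
    then interpret extraction L \<pi> "min_cand L \<pi>" c m .
    have hook_1: "hook_seq L \<pi> (Suc 0) = rim_path (content (min_cand L \<pi>)) m"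
      by (simp add: hook_seq_def rpp_seq_def Q_hook_eq)
    obtain s where s: "\<And>i. i < s \<Longrightarrow> is_rpp L (rpp_seq L \<rho> (Suc i)) \<and> rpp_seq L \<rho> (Suc i) \<noteq> zero_rpp L"
      "rpp_seq L \<rho> (Suc s) = zero_rpp L"
      "\<And>i. Suc i < s \<Longrightarrow> rim_hook_le L (hook_seq L \<rho> (Suc i)) (hook_seq L \<rho> (Suc (Suc i)))"
      "insert_hooks L (map (\<lambda>i. hook_seq L \<rho> (Suc i)) [0..<s]) (zero_rpp L) = Some \<rho>"
      using less.hyps[OF sum_rho_less rho_rpp] by blast
    \<comment> \<open>The one comparison that the induction hypothesis does not supply; a second
      hook exists only if \<rho> is nonzero.\<close>
    have first: "rim_hook_le L (hook_seq L \<pi> (Suc 0)) (hook_seq L \<rho> (Suc 0))" if "0 < s"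
    proof -
      have "\<rho> \<noteq> zero_rpp L" using s(1)[OF that] by (simp add: rpp_seq_def)
      then obtain c' m' where ex': "extraction L \<rho> (min_cand L \<rho>) c' m'"
        using extraction_exists[OF rho_rpp] by blast
      then interpret E: extraction L \<rho> "min_cand L \<rho>" c' m' .
      have "hook_seq L \<rho> (Suc 0) = rim_path (content (min_cand L \<rho>)) m'"
        by (simp add: hook_seq_def rpp_seq_def E.Q_hook_eq)
      then show ?thesis using next_hook_le[OF ex'] hook_1 by simp
    qed
    note shift = rpp_seq_Suc[of \<pi>, unfolded reduce_rpp_eq] hook_seq_Suc[of \<pi>, unfolded reduce_rpp_eq]
    show ?thesis
    proof (intro exI[of _ "Suc s"] conjI allI impI)
      fix i assume "i < Suc s"
      then show "is_rpp L (rpp_seq L \<pi> (Suc i))" "rpp_seq L \<pi> (Suc i) \<noteq> zero_rpp L"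
        using s(1)[of "i - 1"] less.prems False
        by (cases i; simp add: shift rpp_seq_def[of L \<pi> "Suc 0"])+
    next
      show "rpp_seq L \<pi> (Suc (Suc s)) = zero_rpp L" using s(2) by (simp add: shift)
    next
      fix i assume "Suc i < Suc s"
      then show "rim_hook_le L (hook_seq L \<pi> (Suc i)) (hook_seq L \<pi> (Suc (Suc i)))"
        using first s(3)[of "i - 1"] by (cases i) (simp_all add: shift)
    next
      have "map (\<lambda>i. hook_seq L \<pi> (Suc i)) [0..<Suc s] =
          hook_seq L \<pi> (Suc 0) # map (\<lambda>i. hook_seq L \<rho> (Suc i)) [0..<s]"
        by (simp add: map_upt_Suc shift del: upt_Suc)
      then show "insert_hooks L (map (\<lambda>i. hook_seq L \<pi> (Suc i)) [0..<Suc s]) (zero_rpp L) = Some \<pi>"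
        using s(4) insert_hook_eq by (simp add: hook_1 del: upt_Suc)
    qed
  qed
qed

end

theorem mainTheorem15:
  fixes lam :: "nat list" and L :: "cell set" and \<pi> :: "cell \<Rightarrow> enat"
  assumes "is_partition lam" and "L = young_diagram lam" and "is_rpp L \<pi>"
  shows "\<exists>s::nat.
    (\<forall>i \<in> {1..s}. is_rpp L (rpp_seq L \<pi> i) \<and> rpp_seq L \<pi> i \<noteq> zero_rpp L) \<and>
    rpp_seq L \<pi> (s + 1) = zero_rpp L \<and>
    (\<forall>i \<in> {1..<s}. rim_hook_le L (hook_seq L \<pi> i) (hook_seq L \<pi> (i + 1))) \<and>
    insert_hooks L (map (hook_seq L \<pi>) [1..<s + 1]) (zero_rpp L) = Some \<pi>"
proof -
  interpret diagram L
    using young_diagram_diagram assms(1,2) by simp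
  obtain s where s:
    "\<forall>i < s. is_rpp L (rpp_seq L \<pi> (Suc i)) \<and> rpp_seq L \<pi> (Suc i) \<noteq> zero_rpp L"
    "rpp_seq L \<pi> (Suc s) = zero_rpp L"
    "\<forall>i. Suc i < s \<longrightarrow> rim_hook_le L (hook_seq L \<pi> (Suc i)) (hook_seq L \<pi> (Suc (Suc i)))"
    "insert_hooks L (map (\<lambda>i. hook_seq L \<pi> (Suc i)) [0..<s]) (zero_rpp L) = Some \<pi>"
    using extraction_terminates[OF assms(3)] by blast
  have "map (hook_seq L \<pi>) [1..<s + 1] = map (\<lambda>i. hook_seq L \<pi> (Suc i)) [0..<s]"
    by (simp add: map_Suc_upt[symmetric] del: upt_Suc)
  moreover have "is_rpp L (rpp_seq L \<pi> i) \<and> rpp_seq L \<pi> i \<noteq> zero_rpp L" if "i \<in> {1..s}" for i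
    using that s(1) by (cases i) auto
  moreover have "rim_hook_le L (hook_seq L \<pi> i) (hook_seq L \<pi> (i + 1))" if "i \<in> {1..<s}" for i
    using that s(3) by (cases i) auto
  ultimately show ?thesis
    using s(2,4) by (intro exI[of _ s]) (simp del: upt_Suc)
qed

end
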